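(* Let $\mathsf{C}$ be a complete category admitting an extremal projective generator $G$, and let $V := \mathsf{C}(G,-)\colon \mathsf{C}\to\mathsf{Set}$. The following statements hold: (i) $\mathsf{C}$ satisfies ES if, and only if, for every set $I$, every representable implicit partial operation $V^{I} \rightsquigarrow V$ can be extended to a total one. (ii) $\mathsf{C}$ satisfies SES if, and only if, for every set $I$, every principal implicit partial operation $V^{I} \rightsquigarrow V$ can be extended to a total one. If, in addition, $\mathsf{C}$ is well-copowered, then the following statement holds: (iii) $\mathsf{C}$ satisfies ES if, and only if, for every set $I$, every continuous implicit partial operation $V^{I} \rightsquigarrow V$ can be extended to a total one.
   Context: All categories are assumed to be locally small; sets are small, and complete means having all small limits. $\mathsf{Set}$ is the category of sets. An epimorphism $e$ is extremal if, for any decomposition $e = m\circ f$ with $m$ a monomorphism, $m$ is an isomorphism. A category satisfies ES if every epimorphism in it is an extremal epimorphism (equivalently, the category is balanced: every morphism that is both an epimorphism and a monomorphism is an isomorphism). A category satisfies SES if every monomorphism in it is a regular monomorphism (an equaliser of some parallel pair). A category is well-copowered if, for every object $X$, the collection of epimorphic quotients of $X$ (epimorphisms with domain $X$, up to isomorphism) is a small set. An object $G$ of $\mathsf{C}$ is an extremal generator if for every set $I$ the $I$-fold copower $\coprod_I G$ exists in $\mathsf{C}$ and, for every object $X$ of $\mathsf{C}$, the canonical arrow $\coprod_{\mathsf{C}(G,X)} G\to X$ is an extremal epimorphism. An object $A$ is extremal projective if the functor $\mathsf{C}(A,-)\colon\mathsf{C}\to\mathsf{Set}$ preserves extremal epimorphisms;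 equivalently, for every extremal epimorphism $e\colon Y\to X$ and every $f\colon A\to X$ there is $g\colon A\to Y$ with $f=e\circ g$. An extremal projective generator is an object that is both extremal projective and an extremal generator. For a functor $V\colon\mathsf{C}\to\mathsf{Set}$ and a set $I$, $V^I$ denotes the functor $A\mapsto V(A)^I$. An implicit partial operation of arity $I$, written $f\colon V^{I}\rightsquigarrow V$, consists of a subfunctor $d\colon D\rightarrowtail V^{I}$ (the domain of $f$) together with a natural transformation $f\colon D\to V$. It is total if $d$ is the identity. It can be extended to a total one if there is a natural transformation $g\colon V^I\to V$ with $g\circ d=f$. An implicit partial operation with domain $D$ is called: representable if the functor $D$ is representable; continuous if the functor $D$ preserves (small) limits; principal if $D$ is a principal subfunctor of $V^I$. Here a subfunctor of a functor $F\colon\mathsf{C}\to\mathsf{Set}$ is principal if it is of the form $S_x$ for some object $A$ of $\mathsf{C}$ and some $x\in F(A)$, where $S_x(B) := \{F(h)(x)\mid h\colon A\to B\}$ for every object $B$ of $\mathsf{C}$. *)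

theory Defs
  imports "HOL-Library.Equipollence" "HOL-Library.FuncSet"
begin

section \<open>Smallness\<close>

text \<open>
  A set, of whatever type, is small if it has fewer elements than the type \<open>'u\<close>. When \<open>'u\<close> satisfies
  \<open>universe\<close>, its cardinality is a regular strong limit, so the small sets are, up to bijection,
  the sets of a Grothendieck universe. The countable case, where small means finite, is included.
  The argument of type \<open>'u itself\<close> only names the type.
\<close>

definition small :: "'u itself \<Rightarrow> 'x set \<Rightarrow> bool" where
  "small U X \<longleftrightarrow> X \<prec> (UNIV :: 'u set)"

definition universe :: "'u itself \<Rightarrow> bool" where
  "universe U \<longleftrightarrow>
     infinite (UNIV :: 'u set) \<and>
     (\<forall>X :: 'u set. small U X \<longrightarrow> small U (Pow X)) \<and>
     (\<forall>(I :: 'u set) (F :: 'u \<Rightarrow> 'u set).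
        small U I \<and> (\<forall>i\<in>I. small U (F i)) \<longrightarrow> small U (\<Union>i\<in>I. F i))"


section \<open>Categories and functors\<close>

text \<open>\<open>Comp C g f\<close> is the composite of \<open>f\<close> followed by \<open>g\<close>.\<close>

record ('o, 'a) cat =
  Ob :: "'o set"
  Ar :: "'a set"
  Dom :: "'a \<Rightarrow> 'o"
  Cod :: "'a \<Rightarrow> 'o"
  Id :: "'o \<Rightarrow> 'a"
  Comp :: "'a \<Rightarrow> 'a \<Rightarrow> 'a"

definition hom :: "('o, 'a) cat \<Rightarrow> 'o \<Rightarrow> 'o \<Rightarrow> 'a set" where
  "hom C A B = {f \<in> Ar C. Dom C f = A \<and> Cod C f = B}"

locale category =
  fixes C :: "('o, 'a) cat"
  assumes dom_ob: "f \<in> Ar C \<Longrightarrow> Dom C f \<in> Ob C"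
    and cod_ob: "f \<in> Ar C \<Longrightarrow> Cod C f \<in> Ob C"
    and id_hom: "A \<in> Ob C \<Longrightarrow> Id C A \<in> hom C A A"
    and comp_hom: "f \<in> hom C A B \<Longrightarrow> g \<in> hom C B D \<Longrightarrow> Comp C g f \<in> hom C A D"
    and comp_id: "f \<in> hom C A B \<Longrightarrow> Comp C f (Id C A) = f"
    and id_comp: "f \<in> hom C A B \<Longrightarrow> Comp C (Id C B) f = f"
    and comp_assoc: "f \<in> hom C A B \<Longrightarrow> g \<in> hom C B D \<Longrightarrow> h \<in> hom C D E \<Longrightarrow>
           Comp C h (Comp C g f) = Comp C (Comp C h g) f"

record ('o, 'a, 'p, 'b) func =
  FOb :: "'o \<Rightarrow> 'p"
  FAr :: "'a \<Rightarrow> 'b"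

definition is_functor :: "('o, 'a) cat \<Rightarrow> ('p, 'b) cat \<Rightarrow> ('o, 'a, 'p, 'b) func \<Rightarrow> bool" where
  "is_functor C D F \<longleftrightarrow>
     (\<forall>A\<in>Ob C. FOb F A \<in> Ob D) \<and>
     (\<forall>A\<in>Ob C. \<forall>B\<in>Ob C. \<forall>f\<in>hom C A B. FAr F f \<in> hom D (FOb F A) (FOb F B)) \<and>
     (\<forall>A\<in>Ob C. FAr F (Id C A) = Id D (FOb F A)) \<and>
     (\<forall>f\<in>Ar C. \<forall>g\<in>Ar C. Cod C f = Dom C g \<longrightarrow>
        FAr F (Comp C g f) = Comp D (FAr F g) (FAr F f))"

definition comp_functor ::
    "('p, 'b, 'q, 'c) func \<Rightarrow> ('o, 'a, 'p, 'b) func \<Rightarrow> ('o, 'a, 'q, 'c) func" where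
  "comp_functor F T = \<lparr>FOb = (\<lambda>A. FOb F (FOb T A)), FAr = (\<lambda>f. FAr F (FAr T f))\<rparr>"

definition locally_small :: "'u itself \<Rightarrow> ('o, 'a) cat \<Rightarrow> bool" where
  "locally_small U C \<longleftrightarrow> (\<forall>A\<in>Ob C. \<forall>B\<in>Ob C. small U (hom C A B))"


section \<open>Kinds of morphisms\<close>

definition isomorphism :: "('o, 'a) cat \<Rightarrow> 'a \<Rightarrow> bool" where
  "isomorphism C f \<longleftrightarrow> f \<in> Ar C \<and>
     (\<exists>g\<in>hom C (Cod C f) (Dom C f).
        Comp C g f = Id C (Dom C f) \<and> Comp C f g = Id C (Cod C f))"

definition monomorphism :: "('o, 'a) cat \<Rightarrow> 'a \<Rightarrow> bool" where
  "monomorphism C m \<longleftrightarrow> m \<in> Ar C \<and>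
     (\<forall>X\<in>Ob C. \<forall>f\<in>hom C X (Dom C m). \<forall>g\<in>hom C X (Dom C m).
        Comp C m f = Comp C m g \<longrightarrow> f = g)"

definition epimorphism :: "('o, 'a) cat \<Rightarrow> 'a \<Rightarrow> bool" where
  "epimorphism C e \<longleftrightarrow> e \<in> Ar C \<and>
     (\<forall>X\<in>Ob C. \<forall>f\<in>hom C (Cod C e) X. \<forall>g\<in>hom C (Cod C e) X.
        Comp C f e = Comp C g e \<longrightarrow> f = g)"

definition extremal_epi :: "('o, 'a) cat \<Rightarrow> 'a \<Rightarrow> bool" where
  "extremal_epi C e \<longleftrightarrow> epimorphism C e \<and>
     (\<forall>f\<in>Ar C. \<forall>m\<in>Ar C. Cod C f = Dom C m \<and> Comp C m f = e \<and> monomorphism C m \<longrightarrow>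
        isomorphism C m)"

definition is_equaliser :: "('o, 'a) cat \<Rightarrow> 'a \<Rightarrow> 'a \<Rightarrow> 'a \<Rightarrow> bool" where
  "is_equaliser C f g m \<longleftrightarrow>
     (\<exists>E\<in>Ob C. \<exists>A\<in>Ob C. \<exists>B\<in>Ob C.
        m \<in> hom C E A \<and> f \<in> hom C A B \<and> g \<in> hom C A B \<and> Comp C f m = Comp C g m \<and>
        (\<forall>X\<in>Ob C. \<forall>k\<in>hom C X A. Comp C f k = Comp C g k \<longrightarrow>
           (\<exists>!h. h \<in> hom C X E \<and> Comp C m h = k)))"

definition regular_mono :: "('o, 'a) cat \<Rightarrow> 'a \<Rightarrow> bool" where
  "regular_mono C m \<longleftrightarrow> (\<exists>f g. is_equaliser C f g m)"

definition ES :: "('o, 'a) cat \<Rightarrow> bool" where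
  "ES C \<longleftrightarrow> (\<forall>e. epimorphism C e \<longrightarrow> extremal_epi C e)"

definition SES :: "('o, 'a) cat \<Rightarrow> bool" where
  "SES C \<longleftrightarrow> (\<forall>m. monomorphism C m \<longrightarrow> regular_mono C m)"

definition epi_quotients :: "('o, 'a) cat \<Rightarrow> 'o \<Rightarrow> 'a set" where
  "epi_quotients C X = {e. epimorphism C e \<and> Dom C e = X}"

definition quotient_iso :: "('o, 'a) cat \<Rightarrow> 'o \<Rightarrow> ('a \<times> 'a) set" where
  "quotient_iso C X = {(e, e'). e \<in> epi_quotients C X \<and> e' \<in> epi_quotients C X \<and>
     (\<exists>i\<in>hom C (Cod C e) (Cod C e'). isomorphism C i \<and> Comp C i e = e')}"

definition well_copowered :: "'u itself \<Rightarrow> ('o, 'a) cat \<Rightarrow> bool" where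
  "well_copowered U C \<longleftrightarrow> (\<forall>X\<in>Ob C. small U (epi_quotients C X // quotient_iso C X))"


section \<open>Limits\<close>

definition is_cone ::
    "('j, 'k) cat \<Rightarrow> ('o, 'a) cat \<Rightarrow> ('j, 'k, 'o, 'a) func \<Rightarrow> 'o \<Rightarrow> ('j \<Rightarrow> 'a) \<Rightarrow> bool" where
  "is_cone J C T L p \<longleftrightarrow> L \<in> Ob C \<and>
     (\<forall>j\<in>Ob J. p j \<in> hom C L (FOb T j)) \<and>
     (\<forall>k\<in>Ar J. Comp C (FAr T k) (p (Dom J k)) = p (Cod J k))"

definition is_limit ::
    "('j, 'k) cat \<Rightarrow> ('o, 'a) cat \<Rightarrow> ('j, 'k, 'o, 'a) func \<Rightarrow> 'o \<Rightarrow> ('j \<Rightarrow> 'a) \<Rightarrow> bool" where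
  "is_limit J C T L p \<longleftrightarrow> is_cone J C T L p \<and>
     (\<forall>X q. is_cone J C T X q \<longrightarrow>
        (\<exists>!h. h \<in> hom C X L \<and> (\<forall>j\<in>Ob J. Comp C (p j) h = q j)))"

text \<open>Up to isomorphism every small category has its objects and its arrows in \<open>'u\<close>.\<close>

definition small_category :: "'u itself \<Rightarrow> ('u, 'u) cat \<Rightarrow> bool" where
  "small_category U J \<longleftrightarrow> category J \<and> small U (Ob J) \<and> small U (Ar J)"

definition complete :: "'u itself \<Rightarrow> ('o, 'a) cat \<Rightarrow> bool" where
  "complete U C \<longleftrightarrow>
     (\<forall>J (T :: ('u, 'u, 'o, 'a) func). small_category U J \<and> is_functor J C T \<longrightarrow>
        (\<exists>L p. is_limit J C T L p))"

definition preserves_limits ::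
    "'u itself \<Rightarrow> ('o, 'a) cat \<Rightarrow> ('p, 'b) cat \<Rightarrow> ('o, 'a, 'p, 'b) func \<Rightarrow> bool" where
  "preserves_limits U C D F \<longleftrightarrow>
     (\<forall>J (T :: ('u, 'u, 'o, 'a) func) L p.
        small_category U J \<and> is_functor J C T \<and> is_limit J C T L p \<longrightarrow>
        is_limit J D (comp_functor F T) (FOb F L) (\<lambda>j. FAr F (p j)))"


section \<open>Set-valued functors\<close>

text \<open>
  \<open>set_cat U\<close> is the category of small subsets of \<open>'x\<close>, a full subcategory of the category of small
  sets. Functors with values in sets of elements of different types land in different instances, so
  natural transformations between them are given by families of functions. No instance is too
  small for what follows: it has a one-element set and is closed under subsets, so a cone in it is a
  limit cone exactly if it is one among all small sets, and its extremal epimorphisms are the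
  surjections.
\<close>

datatype 'x set_arrow = SetArrow (src: "'x set") (fn: "'x \<Rightarrow> 'x") (tgt: "'x set")

definition set_cat :: "'u itself \<Rightarrow> ('x set, 'x set_arrow) cat" where
  "set_cat U =
     \<lparr>Ob = {X. small U X},
      Ar = {SetArrow X f Y |X f Y. small U X \<and> small U Y \<and> f \<in> X \<rightarrow>\<^sub>E Y},
      Dom = src,
      Cod = tgt,
      Id = (\<lambda>X. SetArrow X (\<lambda>x\<in>X. x) X),
      Comp = (\<lambda>g f. SetArrow (src f) (\<lambda>x\<in>src f. fn g (fn f x)) (tgt g))\<rparr>"

type_synonym ('o, 'a, 'x) set_func = "('o, 'a, 'x set, 'x set_arrow) func"

definition hom_functor :: "('o, 'a) cat \<Rightarrow> 'o \<Rightarrow> ('o, 'a, 'a) set_func" where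
  "hom_functor C A =
     \<lparr>FOb = hom C A,
      FAr = (\<lambda>h. SetArrow (hom C A (Dom C h)) (\<lambda>g\<in>hom C A (Dom C h). Comp C h g)
                          (hom C A (Cod C h)))\<rparr>"

definition power_functor ::
    "('o, 'a) cat \<Rightarrow> 'i set \<Rightarrow> ('o, 'a, 'x) set_func \<Rightarrow> ('o, 'a, 'i \<Rightarrow> 'x) set_func" where
  "power_functor C I V =
     \<lparr>FOb = (\<lambda>A. I \<rightarrow>\<^sub>E FOb V A),
      FAr = (\<lambda>h. SetArrow (I \<rightarrow>\<^sub>E FOb V (Dom C h))
                          (\<lambda>x\<in>I \<rightarrow>\<^sub>E FOb V (Dom C h). \<lambda>i\<in>I. fn (FAr V h) (x i))
                          (I \<rightarrow>\<^sub>E FOb V (Cod C h)))\<rparr>"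

definition nat_trans ::
    "('o, 'a) cat \<Rightarrow> ('o, 'a, 'x) set_func \<Rightarrow> ('o, 'a, 'y) set_func \<Rightarrow> ('o \<Rightarrow> 'x \<Rightarrow> 'y) \<Rightarrow> bool" where
  "nat_trans C F F' t \<longleftrightarrow>
     (\<forall>A\<in>Ob C. t A \<in> FOb F A \<rightarrow> FOb F' A) \<and>
     (\<forall>h\<in>Ar C. \<forall>x\<in>FOb F (Dom C h).
        t (Cod C h) (fn (FAr F h) x) = fn (FAr F' h) (t (Dom C h) x))"

definition representable :: "('o, 'a) cat \<Rightarrow> ('o, 'a, 'x) set_func \<Rightarrow> bool" where
  "representable C F \<longleftrightarrow>
     (\<exists>R\<in>Ob C. \<exists>t. nat_trans C (hom_functor C R) F t \<and>
        (\<forall>A\<in>Ob C. bij_betw (t A) (hom C R A) (FOb F A)))"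

definition subfunctor ::
    "'u itself \<Rightarrow> ('o, 'a) cat \<Rightarrow> ('o, 'a, 'x) set_func \<Rightarrow> ('o, 'a, 'x) set_func \<Rightarrow> bool" where
  "subfunctor U C D F \<longleftrightarrow> is_functor C (set_cat U) D \<and>
     (\<forall>A\<in>Ob C. FOb D A \<subseteq> FOb F A) \<and>
     (\<forall>h\<in>Ar C. \<forall>x\<in>FOb D (Dom C h). fn (FAr D h) x = fn (FAr F h) x)"

definition principal_subfunctor ::
    "'u itself \<Rightarrow> ('o, 'a) cat \<Rightarrow> ('o, 'a, 'x) set_func \<Rightarrow> ('o, 'a, 'x) set_func \<Rightarrow> bool" where
  "principal_subfunctor U C D F \<longleftrightarrow> subfunctor U C D F \<and>
     (\<exists>A\<in>Ob C. \<exists>x\<in>FOb F A. \<forall>B\<in>Ob C. FOb D B = {fn (FAr F h) x |h. h \<in> hom C A B})"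


section \<open>Extremal projective generators\<close>

definition is_copower ::
    "('o, 'a) cat \<Rightarrow> 'i set \<Rightarrow> 'o \<Rightarrow> 'o \<Rightarrow> ('i \<Rightarrow> 'a) \<Rightarrow> bool" where
  "is_copower C I G P inc \<longleftrightarrow> P \<in> Ob C \<and> (\<forall>i\<in>I. inc i \<in> hom C G P) \<and>
     (\<forall>X\<in>Ob C. \<forall>f. (\<forall>i\<in>I. f i \<in> hom C G X) \<longrightarrow>
        (\<exists>!h. h \<in> hom C P X \<and> (\<forall>i\<in>I. Comp C h (inc i) = f i)))"

text \<open>
  The second clause does not depend on the choice of the copower of \<open>G\<close> over \<open>hom C G X\<close>, and \<open>c\<close> is
  the canonical arrow. If \<open>hom C G X\<close> is small, such a copower exists by the first clause.
\<close>

definition extremal_generator :: "'u itself \<Rightarrow> ('o, 'a) cat \<Rightarrow> 'o \<Rightarrow> bool" where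
  "extremal_generator U C G \<longleftrightarrow> G \<in> Ob C \<and>
     (\<forall>I :: 'u set. small U I \<longrightarrow> (\<exists>P inc. is_copower C I G P inc)) \<and>
     (\<forall>X\<in>Ob C. \<forall>P inc. is_copower C (hom C G X) G P inc \<longrightarrow>
        (\<forall>c\<in>hom C P X. (\<forall>g\<in>hom C G X. Comp C c (inc g) = g) \<longrightarrow> extremal_epi C c))"

definition extremal_projective :: "'u itself \<Rightarrow> ('o, 'a) cat \<Rightarrow> 'o \<Rightarrow> bool" where
  "extremal_projective U C A \<longleftrightarrow> A \<in> Ob C \<and>
     (\<forall>e. extremal_epi C e \<longrightarrow> extremal_epi (set_cat U) (FAr (hom_functor C A) e))"

definition extremal_projective_generator :: "'u itself \<Rightarrow> ('o, 'a) cat \<Rightarrow> 'o \<Rightarrow> bool" where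
  "extremal_projective_generator U C G \<longleftrightarrow> extremal_projective U C G \<and> extremal_generator U C G"


section \<open>Implicit partial operations\<close>

definition implicit_partial_operation ::
    "'u itself \<Rightarrow> ('o, 'a) cat \<Rightarrow> ('o, 'a, 'x) set_func \<Rightarrow> 'i set \<Rightarrow>
     ('o, 'a, 'i \<Rightarrow> 'x) set_func \<Rightarrow> ('o \<Rightarrow> ('i \<Rightarrow> 'x) \<Rightarrow> 'x) \<Rightarrow> bool" where
  "implicit_partial_operation U C V I D f \<longleftrightarrow>
     subfunctor U C D (power_functor C I V) \<and> nat_trans C D V f"

definition extends_to_total ::
    "('o, 'a) cat \<Rightarrow> ('o, 'a, 'x) set_func \<Rightarrow> 'i set \<Rightarrow>
     ('o, 'a, 'i \<Rightarrow> 'x) set_func \<Rightarrow> ('o \<Rightarrow> ('i \<Rightarrow> 'x) \<Rightarrow> 'x) \<Rightarrow> bool" where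
  "extends_to_total C V I D f \<longleftrightarrow>
     (\<exists>g. nat_trans C (power_functor C I V) V g \<and> (\<forall>A\<in>Ob C. \<forall>x\<in>FOb D A. g A x = f A x))"

end

theory Submission
  imports Defs
begin

text \<open>
  Write \<open>V\<close> for \<open>C(G,-)\<close>. Since canonical arrows are extremal epimorphisms, \<open>V\<close> is faithful and a
  monomorphism \<open>m\<close> is invertible as soon as \<open>V m\<close> is surjective (\<open>mono_surj_iso\<close>). Since \<open>G\<close> is
  extremal projective, \<open>V e\<close> is surjective for every extremal epimorphism \<open>e\<close>.

  Let \<open>P0\<close> be the \<open>I\<close>-fold copower of \<open>G\<close>. The elements of \<open>V(A)\<^sup>I\<close> are the arrows from \<open>P0\<close> to \<open>A\<close>, so by
  Yoneda the total operations of arity \<open>I\<close> are the elements of \<open>V(P0)\<close>. If the domain of a partial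
  operation consists of the multiples \<open>h e\<close> of one arrow \<open>e : P0 \<rightarrow> R\<close>, then the operation is
  determined by its value \<open>u \<in> V(R)\<close> at \<open>e\<close>, and it extends to a total one exactly if \<open>u\<close> factors
  through \<open>e\<close> (\<open>extends_iff_factors\<close>). In the other direction, an element \<open>u\<close> such that \<open>h e = k e\<close>
  always implies \<open>h u = k u\<close> is the value at \<open>e\<close> of an operation on the principal subfunctor generated
  by \<open>e\<close>, and this subfunctor is representable if \<open>e\<close> is an epimorphism (\<open>principal_operation\<close>).
  The first two equivalences thus turn into statements about factoring elements through arrows.

  Representable domains: here \<open>e\<close> is an epimorphism. Under ES it is extremal, so every \<open>u\<close> factors
  through it. Conversely, let \<open>m : A \<rightarrow> B\<close> be a monomorphism and an epimorphism, and let \<open>c\<close> be the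
  canonical arrow onto \<open>A\<close>. If every \<open>u \<in> V(B)\<close> factors through the epimorphism \<open>m c\<close>, then \<open>V m\<close> is
  surjective and \<open>m\<close> is invertible.

  Principal domains: here \<open>e\<close> is arbitrary. Factor it as an extremal epimorphism followed by a
  monomorphism \<open>p\<close>. Under SES, \<open>p\<close> is an equaliser of two arrows \<open>h\<close> and \<open>k\<close>; they agree on \<open>e\<close>, hence on \<open>u\<close>,
  so \<open>u\<close> factors through \<open>p\<close>, and by projectivity through \<open>e\<close>. Conversely, extending the operations
  generated by \<open>m c\<close> for a monomorphism \<open>m\<close> shows that an element of \<open>V(B)\<close> outside the image of \<open>V m\<close> is
  separated by a pair of arrows that agree on \<open>m\<close>. The product of one such pair for each of these
  elements is a single pair with equaliser \<open>m\<close> (\<open>regular_mono_of_separating\<close>).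

  Continuous domains: representable functors preserve limits. Conversely, if \<open>C\<close> is well-copowered,
  every continuous subfunctor of \<open>V\<^sup>I\<close> is representable (\<open>continuous_imp_representable\<close>), by an adjoint
  functor theorem whose solution set consists of epimorphic quotients of \<open>P0\<close>. This reduces the
  third equivalence to the first. The quotients arise by passing to the smallest subobject on which
  a given element of a continuous functor is defined
  (\<open>minimal_subobject\<close>); for the functor \<open>C(X,-)\<close> the same construction yields the factorisation
  used for principal domains.
\<close>

section \<open>Small sets\<close>

lemma small_lepoll: "X \<lesssim> Y \<Longrightarrow> small U Y \<Longrightarrow> small U X"
  unfolding small_def by (rule lesspoll_trans1)

lemma small_subset: "X \<subseteq> Y \<Longrightarrow> small U Y \<Longrightarrow> small U X"
  by (rule small_lepoll[OF subset_imp_lepoll])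

lemma small_image: "small U X \<Longrightarrow> small U (f ` X)"
  by (rule small_lepoll[OF image_lepoll])

lemma small_copy:
  assumes "small (U :: 'u itself) X"
  obtains i :: "'x \<Rightarrow> 'u" where "inj_on i X"
  using assms unfolding small_def lesspoll_def lepoll_def by blast

lemma small_finite:
  assumes "universe U" "finite X" shows "small U X"
  using assms unfolding universe_def small_def
  by (meson finite_lesspoll_infinite)

lemma small_Pow:
  assumes "universe (U :: 'u itself)" "small U X" shows "small U (Pow X)"
proof -
  obtain i :: "'a \<Rightarrow> 'u" where i: "inj_on i X" using assms(2) by (rule small_copy)
  have "small U (Pow (i ` X))"
    using assms small_image[OF assms(2)] unfolding universe_def by blast
  moreover have "inj_on ((`) i) (Pow X)" using i by (rule inj_on_image_Pow)
  then have "Pow X \<lesssim> Pow (i ` X)" unfolding lepoll_def by (intro exI[of _ "(`) i"]) auto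
  ultimately show ?thesis using small_lepoll by blast
qed

text \<open>
  Smallness is a strict inequality of cardinals, so this is the fact that an infinite cardinal is
  not the sum of two smaller ones.
\<close>

lemma small_Plus:
  assumes "universe (U :: 'u itself)" "small U X" "small U Y" shows "small U (X <+> Y)"
proof -
  have less: "small U Z \<longleftrightarrow> ordLess2 (card_of Z) (card_of (UNIV :: 'u set))" for Z :: "'z set"
  proof -
    have 1: "A \<lesssim> B \<longleftrightarrow> ordLeq2 (card_of A) (card_of B)" for A :: "'p set" and B :: "'q set"
      unfolding lepoll_def card_of_ordLeq[symmetric] ..
    show ?thesis
      unfolding small_def lesspoll_def eqpoll_iff_card_of_ordIso 1
      using ordLeq_iff_ordLess_or_ordIso not_ordLess_ordIso by blast
  qed
  show ?thesis using assms unfolding less universe_def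
    by (meson card_of_Plus_ordLess_infinite)
qed

section \<open>Arrows\<close>

lemma ex1_unique: "\<exists>!x. P x \<Longrightarrow> P a \<Longrightarrow> P b \<Longrightarrow> a = b"
  by blast

lemma homD: "f \<in> hom C A B \<Longrightarrow> f \<in> Ar C \<and> Dom C f = A \<and> Cod C f = B"
  by (simp add: hom_def)

lemma hom_Ar: "f \<in> Ar C \<Longrightarrow> f \<in> hom C (Dom C f) (Cod C f)"
  by (simp add: hom_def)

context category
begin

abbreviation compose (infixr "\<cdot>" 70) where "g \<cdot> f \<equiv> Comp C g f"

lemma hom_ob: "f \<in> hom C A B \<Longrightarrow> A \<in> Ob C \<and> B \<in> Ob C"
  using dom_ob cod_ob by (auto simp: hom_def)

lemma mono_hom: "monomorphism C m \<Longrightarrow> m \<in> hom C (Dom C m) (Cod C m)"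
  by (simp add: monomorphism_def hom_Ar)

lemma monoI:
  assumes "m \<in> hom C A B"
    and "\<And>X f g. f \<in> hom C X A \<Longrightarrow> g \<in> hom C X A \<Longrightarrow> m \<cdot> f = m \<cdot> g \<Longrightarrow> f = g"
  shows "monomorphism C m"
  using assms unfolding monomorphism_def by (auto simp: hom_def)

lemma monoD:
  assumes "monomorphism C m" "m \<in> hom C A B" "f \<in> hom C X A" "g \<in> hom C X A" "m \<cdot> f = m \<cdot> g"
  shows "f = g"
  using assms hom_ob unfolding monomorphism_def by (metis homD)

lemma epiI:
  assumes "e \<in> hom C A B"
    and "\<And>X f g. f \<in> hom C B X \<Longrightarrow> g \<in> hom C B X \<Longrightarrow> f \<cdot> e = g \<cdot> e \<Longrightarrow> f = g"
  shows "epimorphism C e"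
  using assms unfolding epimorphism_def by (auto simp: hom_def)

lemma epiD:
  assumes "epimorphism C e" "e \<in> hom C A B" "f \<in> hom C B X" "g \<in> hom C B X" "f \<cdot> e = g \<cdot> e"
  shows "f = g"
  using assms hom_ob unfolding epimorphism_def by (metis homD)

lemma isoE:
  assumes "isomorphism C f" "f \<in> hom C A B"
  obtains g where "g \<in> hom C B A" "g \<cdot> f = Id C A" "f \<cdot> g = Id C B"
  using assms unfolding isomorphism_def by (metis homD)

lemma extremalD:
  assumes "extremal_epi C e" "f \<in> hom C X M" "m \<in> hom C M Y" "m \<cdot> f = e" "monomorphism C m"
  shows "isomorphism C m"
  using assms unfolding extremal_epi_def by (metis homD)

lemma mono_comp:
  assumes "monomorphism C m" "m \<in> hom C A B" "monomorphism C n" "n \<in> hom C B D"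
  shows "monomorphism C (n \<cdot> m)"
proof (rule monoI[OF comp_hom[OF assms(2,4)]])
  fix X f g assume f: "f \<in> hom C X A" "g \<in> hom C X A" and eq: "(n \<cdot> m) \<cdot> f = (n \<cdot> m) \<cdot> g"
  have "n \<cdot> (m \<cdot> f) = n \<cdot> (m \<cdot> g)" using eq comp_assoc[OF _ assms(2,4)] f by simp
  then have "m \<cdot> f = m \<cdot> g" using monoD[OF assms(3,4)] comp_hom[OF _ assms(2)] f by blast
  then show "f = g" using monoD[OF assms(1,2)] f by blast
qed

lemma epi_comp:
  assumes "epimorphism C e" "e \<in> hom C A B" "epimorphism C f" "f \<in> hom C B D"
  shows "epimorphism C (f \<cdot> e)"
proof (rule epiI[OF comp_hom[OF assms(2,4)]])
  fix X h k assume h: "h \<in> hom C D X" "k \<in> hom C D X" and eq: "h \<cdot> f \<cdot> e = k \<cdot> f \<cdot> e"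
  have "(h \<cdot> f) \<cdot> e = (k \<cdot> f) \<cdot> e" using eq comp_assoc[OF assms(2,4)] h by simp
  then have "h \<cdot> f = k \<cdot> f" using epiD[OF assms(1,2)] comp_hom[OF assms(4)] h by blast
  then show "h = k" using epiD[OF assms(3,4)] h by blast
qed

lemma equaliser_mono:
  assumes "is_equaliser C h k q"
  shows "monomorphism C q"
proof -
  from assms obtain E A B where t: "q \<in> hom C E A" "h \<in> hom C A B" "k \<in> hom C A B" "h \<cdot> q = k \<cdot> q"
    and u: "\<And>X l. l \<in> hom C X A \<Longrightarrow> h \<cdot> l = k \<cdot> l \<Longrightarrow> \<exists>!j. j \<in> hom C X E \<and> q \<cdot> j = l"
    unfolding is_equaliser_def using hom_ob by metis
  show ?thesis
  proof (rule monoI[OF t(1)])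
    fix X f g assume fg: "f \<in> hom C X E" "g \<in> hom C X E" "q \<cdot> f = q \<cdot> g"
    have "h \<cdot> (q \<cdot> f) = k \<cdot> (q \<cdot> f)" using t fg comp_assoc by metis
    from u[OF comp_hom[OF fg(1) t(1)] this] show "f = g" using fg by auto
  qed
qed

text \<open>
  In a decomposition \<open>e = m f\<close> of an epimorphism the second factor is an epimorphism, and a
  monomorphism \<open>m\<close> decomposes as \<open>m \<cdot> Id\<close>.
\<close>

lemma ES_iff_balanced:
  "ES C \<longleftrightarrow> (\<forall>m. monomorphism C m \<and> epimorphism C m \<longrightarrow> isomorphism C m)"
proof
  assume ES: "ES C"
  show "\<forall>m. monomorphism C m \<and> epimorphism C m \<longrightarrow> isomorphism C m"
  proof (intro allI impI)
    fix m assume m: "monomorphism C m \<and> epimorphism C m"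
    then have h: "m \<in> hom C (Dom C m) (Cod C m)" by (simp add: monomorphism_def hom_Ar)
    have "extremal_epi C m" using ES m by (simp add: ES_def)
    from extremalD[OF this _ h comp_id[OF h]] show "isomorphism C m"
      using m h id_hom hom_ob by metis
  qed
next
  assume b: "\<forall>m. monomorphism C m \<and> epimorphism C m \<longrightarrow> isomorphism C m"
  have "isomorphism C m"
    if e: "epimorphism C e" and f: "f \<in> Ar C" and mA: "m \<in> Ar C" and t: "Cod C f = Dom C m" "m \<cdot> f = e"
      and m: "monomorphism C m" for e f m
  proof -
    have f': "f \<in> hom C (Dom C f) (Dom C m)" and m': "m \<in> hom C (Dom C m) (Cod C m)"
      using f mA t by (auto simp: hom_def)
    have e': "e \<in> hom C (Dom C f) (Cod C m)" using comp_hom[OF f' m'] t by simp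
    have "epimorphism C m"
    proof (rule epiI[OF m'])
      fix X h k assume h: "h \<in> hom C (Cod C m) X" "k \<in> hom C (Cod C m) X" and eq: "h \<cdot> m = k \<cdot> m"
      have "h \<cdot> e = k \<cdot> e" using comp_assoc[OF f' m'] h eq t(2) by simp
      then show "h = k" using epiD[OF e e'] h by blast
    qed
    then show ?thesis using b m by blast
  qed
  then show "ES C" unfolding ES_def extremal_epi_def by blast
qed

end

section \<open>Set-valued functors\<close>

abbreviation act :: "('o, 'a, 'x) set_func \<Rightarrow> 'a \<Rightarrow> 'x \<Rightarrow> 'x" where
  "act D h x \<equiv> fn (FAr D h) x"

lemma hom_set_cat:
  "hom (set_cat U) X Y = {SetArrow X f Y |f. small U X \<and> small U Y \<and> f \<in> X \<rightarrow>\<^sub>E Y}"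
  by (auto simp: hom_def set_cat_def)

lemma set_cat_Ob: "X \<in> Ob (set_cat U) \<longleftrightarrow> small U X"
  by (simp add: set_cat_def)

lemma set_cat_comp:
  "Comp (set_cat U) g f = SetArrow (src f) (\<lambda>x\<in>src f. fn g (fn f x)) (tgt g)"
  by (simp add: set_cat_def)

lemma set_arrow_eqI:
  assumes "f \<in> hom (set_cat U) X Y" "g \<in> hom (set_cat U) X Y" "\<And>x. x \<in> X \<Longrightarrow> fn f x = fn g x"
  shows "f = g"
proof -
  obtain f' g' where f: "f = SetArrow X f' Y" "f' \<in> X \<rightarrow>\<^sub>E Y" and g: "g = SetArrow X g' Y" "g' \<in> X \<rightarrow>\<^sub>E Y"
    using assms(1,2) unfolding hom_set_cat by blast
  have "f' = g'" by (rule PiE_ext[OF f(2) g(2)]) (use assms(3) f g in simp)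
  then show ?thesis using f g by simp
qed

lemma set_arrow:
  assumes "f \<in> hom (set_cat U) X Y"
  shows "src f = X" "tgt f = Y" "x \<in> X \<Longrightarrow> fn f x \<in> Y"
  using assms unfolding hom_set_cat by auto

text \<open>
  An extremal epimorphism cannot factor through the inclusion of its image unless that inclusion
  is invertible.
\<close>

lemma extremal_epi_set_cat_surj:
  assumes e: "extremal_epi (set_cat U) e" "e \<in> hom (set_cat U) X Y" and y: "y \<in> Y"
  shows "\<exists>x\<in>X. fn e x = y"
proof -
  let ?S = "set_cat U :: ('a set, 'a set_arrow) cat"
  obtain f where f: "e = SetArrow X f Y" "small U X" "small U Y" "f \<in> X \<rightarrow>\<^sub>E Y"
    using e(2) unfolding hom_set_cat by auto
  let ?Z = "f ` X"
  let ?m = "SetArrow ?Z (\<lambda>z\<in>?Z. z) Y" and ?f = "SetArrow X f ?Z"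
  have Z: "small U ?Z" "?Z \<subseteq> Y" using f small_image by auto
  have m: "?m \<in> hom ?S ?Z Y" using f Z by (auto simp: hom_set_cat)
  have f': "?f \<in> hom ?S X ?Z" using f Z by (auto simp: hom_set_cat)
  have "monomorphism ?S ?m" unfolding monomorphism_def
  proof (intro conjI ballI impI)
    show "?m \<in> Ar ?S" using m by (simp add: hom_def)
    fix W g h assume gh: "g \<in> hom ?S W (Dom ?S ?m)" "h \<in> hom ?S W (Dom ?S ?m)"
      and eq: "Comp ?S ?m g = Comp ?S ?m h"
    have D: "Dom ?S ?m = ?Z" by (simp add: set_cat_def)
    show "g = h"
    proof (rule set_arrow_eqI[OF gh])
      fix w assume w: "w \<in> W"
      have "fn (Comp ?S ?m g) w = fn (Comp ?S ?m h) w" using eq by simp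
      then show "fn g w = fn h w"
        using set_arrow[OF gh(1)[unfolded D]] set_arrow[OF gh(2)[unfolded D]] w by (simp add: set_cat_comp)
    qed
  qed
  moreover have "Comp ?S ?m ?f = e"
    unfolding set_cat_comp f(1) using f(4) by (auto intro!: PiE_ext[of _ X "\<lambda>_. Y"])
  moreover have "?m \<in> Ar ?S" "?f \<in> Ar ?S" "Cod ?S ?f = Dom ?S ?m"
    using m f' by (auto simp: hom_def)
  ultimately have "isomorphism ?S ?m" using e(1) unfolding extremal_epi_def by blast
  then obtain g where g: "g \<in> hom ?S Y ?Z" "Comp ?S ?m g = Id ?S Y"
    unfolding isomorphism_def by (auto simp: set_cat_def)
  have "fn (Comp ?S ?m g) y = y" unfolding g(2) using y by (simp add: set_cat_def)
  then have "fn g y = y" using set_arrow[OF g(1)] y by (simp add: set_cat_comp)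
  then have "y \<in> ?Z" using set_arrow(3)[OF g(1) y] by simp
  then show ?thesis using f(1) by auto
qed

lemma functor_hom: "is_functor C S D \<Longrightarrow> category C \<Longrightarrow> h \<in> hom C A B \<Longrightarrow> FAr D h \<in> hom S (FOb D A) (FOb D B)"
  unfolding is_functor_def using category.hom_ob by metis

locale set_functor = category C for C :: "('o, 'a) cat" +
  fixes U :: "'u itself" and D :: "('o, 'a, 'x) set_func"
  assumes is_fun: "is_functor C (set_cat U) D"
begin

lemma ar_hom: "h \<in> hom C A B \<Longrightarrow> FAr D h \<in> hom (set_cat U) (FOb D A) (FOb D B)"
  by (rule functor_hom[OF is_fun category_axioms])

lemma small_ob: "A \<in> Ob C \<Longrightarrow> small U (FOb D A)"
  using is_fun unfolding is_functor_def set_cat_Ob by blast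

lemma act_in: "h \<in> hom C A B \<Longrightarrow> x \<in> FOb D A \<Longrightarrow> act D h x \<in> FOb D B"
  using ar_hom set_arrow(3) by metis

lemma act_id: "A \<in> Ob C \<Longrightarrow> x \<in> FOb D A \<Longrightarrow> act D (Id C A) x = x"
  using is_fun unfolding is_functor_def by (simp add: set_cat_def)

lemma act_comp:
  assumes "h \<in> hom C A B" "k \<in> hom C B E" "x \<in> FOb D A"
  shows "act D (k \<cdot> h) x = act D k (act D h x)"
proof -
  have "FAr D (k \<cdot> h) = Comp (set_cat U) (FAr D k) (FAr D h)"
    using is_fun assms unfolding is_functor_def by (simp add: hom_def)
  then show ?thesis using set_arrow[OF ar_hom[OF assms(1)]] assms(3) by (simp add: set_cat_comp)
qed

end

section \<open>Limits over small categories of arbitrary type\<close>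

text \<open>
  Completeness speaks of categories whose objects and arrows lie in \<open>'u\<close>. Diagrams that arise in
  practice are indexed by other types; \<open>relabel\<close> transports their shape along injections.
\<close>

definition relabel :: "('j \<Rightarrow> 'p) \<Rightarrow> ('k \<Rightarrow> 'q) \<Rightarrow> ('j, 'k) cat \<Rightarrow> ('p, 'q) cat" where
  "relabel i k J = (let j = inv_into (Ob J) i; l = inv_into (Ar J) k in
     \<lparr>Ob = i ` Ob J, Ar = k ` Ar J, Dom = (\<lambda>f. i (Dom J (l f))), Cod = (\<lambda>f. i (Cod J (l f))),
      Id = (\<lambda>A. k (Id J (j A))), Comp = (\<lambda>g f. k (Comp J (l g) (l f)))\<rparr>)"

locale relabelling = J: category J for J :: "('j, 'k) cat" +
  fixes i :: "'j \<Rightarrow> 'p" and k :: "'k \<Rightarrow> 'q"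
  assumes inj_i: "inj_on i (Ob J)" and inj_k: "inj_on k (Ar J)"
begin

abbreviation J' where "J' \<equiv> relabel i k J"

lemma relabel_simps:
  "Ob J' = i ` Ob J" "Ar J' = k ` Ar J"
  "f \<in> Ar J \<Longrightarrow> Dom J' (k f) = i (Dom J f)"
  "f \<in> Ar J \<Longrightarrow> Cod J' (k f) = i (Cod J f)"
  "A \<in> Ob J \<Longrightarrow> Id J' (i A) = k (Id J A)"
  "f \<in> Ar J \<Longrightarrow> g \<in> Ar J \<Longrightarrow> Comp J' (k g) (k f) = k (Comp J g f)"
  by (simp_all add: relabel_def Let_def inv_into_f_f[OF inj_i] inv_into_f_f[OF inj_k])

lemma relabel_hom:
  "A \<in> Ob J \<Longrightarrow> B \<in> Ob J \<Longrightarrow> hom J' (i A) (i B) = k ` hom J A B"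
  unfolding hom_def relabel_simps
  by (auto simp: relabel_simps inj_on_eq_iff[OF inj_i] J.dom_ob J.cod_ob)

lemma relabel_homE:
  assumes "f \<in> hom J' A B"
  obtains f0 A0 B0 where "f = k f0" "A = i A0" "B = i B0" "f0 \<in> hom J A0 B0" "A0 \<in> Ob J" "B0 \<in> Ob J"
proof -
  from assms obtain f0 where f0: "f0 \<in> Ar J" "f = k f0" by (auto simp: hom_def relabel_simps)
  show thesis
    by (rule that[of f0 "Dom J f0" "Cod J f0"])
      (use f0 assms in \<open>auto simp: hom_def relabel_simps J.dom_ob J.cod_ob\<close>)
qed

lemma relabel_category: "category J'"
proof
  fix f assume "f \<in> Ar J'"
  then show "Dom J' f \<in> Ob J'" "Cod J' f \<in> Ob J'"
    by (auto simp: relabel_simps J.dom_ob J.cod_ob)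
next
  fix A assume "A \<in> Ob J'"
  then obtain A0 where A: "A0 \<in> Ob J" "A = i A0" by (auto simp: relabel_simps)
  then show "Id J' A \<in> hom J' A A"
    using J.id_hom[OF A(1)] by (simp add: relabel_simps relabel_hom)
next
  fix f A B assume f: "f \<in> hom J' A B"
  then obtain f0 A0 B0 where f0: "f = k f0" "A = i A0" "B = i B0" "f0 \<in> hom J A0 B0" "A0 \<in> Ob J" "B0 \<in> Ob J"
    by (rule relabel_homE)
  have mem: "f0 \<in> Ar J" "Id J A0 \<in> Ar J" "Id J B0 \<in> Ar J" using f0 J.id_hom by (auto simp: hom_def)
  show "Comp J' f (Id J' A) = f" "Comp J' (Id J' B) f = f"
    using f0 mem by (simp_all add: relabel_simps J.comp_id J.id_comp)
  fix g D assume "g \<in> hom J' B D"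
  then obtain g0 B1 D0 where "g = k g0" "B = i B1" "D = i D0" "g0 \<in> hom J B1 D0" "B1 \<in> Ob J" "D0 \<in> Ob J"
    by (rule relabel_homE)
  with f0 have g0: "g = k g0" "D = i D0" "g0 \<in> hom J B0 D0" "D0 \<in> Ob J"
    by (auto simp: inj_on_eq_iff[OF inj_i])
  have gA: "g0 \<in> Ar J" "Comp J g0 f0 \<in> Ar J" "Comp J g0 f0 \<in> hom J A0 D0"
    using g0 J.comp_hom[OF f0(4) g0(3)] by (auto simp: hom_def)
  show "Comp J' g f \<in> hom J' A D"
    using f0 g0 gA mem by (simp add: relabel_simps relabel_hom)
  fix h E assume "h \<in> hom J' D E"
  then obtain h0 D1 E0 where "h = k h0" "D = i D1" "E = i E0" "h0 \<in> hom J D1 E0" "D1 \<in> Ob J" "E0 \<in> Ob J"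
    by (rule relabel_homE)
  with g0 have h0: "h = k h0" "E = i E0" "h0 \<in> hom J D0 E0" "E0 \<in> Ob J"
    by (auto simp: inj_on_eq_iff[OF inj_i])
  have hA: "h0 \<in> Ar J" "Comp J h0 g0 \<in> Ar J"
    using h0 J.comp_hom[OF g0(3) h0(3)] by (auto simp: hom_def)
  show "Comp J' h (Comp J' g f) = Comp J' (Comp J' h g) f"
    using f0 g0 h0 gA hA mem by (simp add: relabel_simps J.comp_assoc[OF f0(4) g0(3) h0(3)])
qed

abbreviation relabel_func where
  "relabel_func T \<equiv>
     \<lparr>FOb = (\<lambda>A. FOb T (inv_into (Ob J) i A)), FAr = (\<lambda>f. FAr T (inv_into (Ar J) k f))\<rparr>"

lemma relabel_functor:
  assumes T: "is_functor J C T"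
  shows "is_functor J' C (relabel_func T)"
  unfolding is_functor_def
proof (intro conjI ballI impI)
  fix A B f assume f: "f \<in> hom J' A B"
  then obtain f0 A0 B0 where f0: "f = k f0" "A = i A0" "B = i B0" "f0 \<in> hom J A0 B0" "A0 \<in> Ob J" "B0 \<in> Ob J"
    by (rule relabel_homE)
  then have "f0 \<in> Ar J" by (simp add: hom_def)
  then show "FAr (relabel_func T) f \<in> hom C (FOb (relabel_func T) A) (FOb (relabel_func T) B)"
    using f0 T unfolding is_functor_def by (simp add: inv_into_f_f[OF inj_i] inv_into_f_f[OF inj_k])
next
  fix f g assume "f \<in> Ar J'" "g \<in> Ar J'" and e: "Cod J' f = Dom J' g"
  then obtain f0 g0 where fg: "f0 \<in> Ar J" "g0 \<in> Ar J" "f = k f0" "g = k g0"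
    by (auto simp: relabel_simps)
  then have e': "Cod J f0 = Dom J g0" using e by (simp add: relabel_simps inj_on_eq_iff[OF inj_i] J.dom_ob J.cod_ob)
  have "Comp J g0 f0 \<in> Ar J"
    using J.comp_hom[of f0 "Dom J f0" "Cod J f0" g0 "Cod J g0"] e' fg by (simp add: hom_def)
  then show "FAr (relabel_func T) (Comp J' g f) = Comp C (FAr (relabel_func T) g) (FAr (relabel_func T) f)"
    using fg e' T unfolding is_functor_def by (simp add: relabel_simps inv_into_f_f[OF inj_k])
next
  fix A assume "A \<in> Ob J'"
  then obtain A0 where A: "A0 \<in> Ob J" "A = i A0" by (auto simp: relabel_simps)
  moreover have "Id J A0 \<in> Ar J" using J.id_hom A by (simp add: hom_def)
  ultimately show "FOb (relabel_func T) A \<in> Ob C" "FAr (relabel_func T) (Id J' A) = Id C (FOb (relabel_func T) A)"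
    using T unfolding is_functor_def by (simp_all add: relabel_simps inv_into_f_f[OF inj_i] inv_into_f_f[OF inj_k])
qed

lemma relabel_cone: "is_cone J' C (relabel_func T) L p \<longleftrightarrow> is_cone J C T L (\<lambda>j. p (i j))"
  unfolding is_cone_def relabel_simps
  by (simp add: relabel_simps inv_into_f_f[OF inj_i] inv_into_f_f[OF inj_k])

lemma relabel_limit: "is_limit J' C (relabel_func T) L p \<longleftrightarrow> is_limit J C T L (\<lambda>j. p (i j))"
proof -
  have *: "is_cone J C T X (\<lambda>j. q (inv_into (Ob J) i (i j))) \<longleftrightarrow> is_cone J C T X q" for X q
    unfolding is_cone_def by (simp add: inv_into_f_f[OF inj_i] J.dom_ob J.cod_ob)
  show ?thesis
  proof
    assume L: "is_limit J' C (relabel_func T) L p"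
    show "is_limit J C T L (\<lambda>j. p (i j))" unfolding is_limit_def
    proof (intro conjI allI impI)
      show "is_cone J C T L (\<lambda>j. p (i j))" using L unfolding is_limit_def relabel_cone by blast
      fix X q assume "is_cone J C T X q"
      then have "is_cone J' C (relabel_func T) X (\<lambda>j. q (inv_into (Ob J) i j))"
        unfolding relabel_cone * .
      then have "\<exists>!h. h \<in> hom C X L \<and> (\<forall>j\<in>Ob J'. Comp C (p j) h = q (inv_into (Ob J) i j))"
        using L unfolding is_limit_def by blast
      then show "\<exists>!h. h \<in> hom C X L \<and> (\<forall>j\<in>Ob J. Comp C (p (i j)) h = q j)"
        by (simp add: relabel_simps inv_into_f_f[OF inj_i])
    qed
  next
    assume L: "is_limit J C T L (\<lambda>j. p (i j))"
    show "is_limit J' C (relabel_func T) L p" unfolding is_limit_def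
    proof (intro conjI allI impI)
      show "is_cone J' C (relabel_func T) L p" using L unfolding is_limit_def relabel_cone by blast
      fix X q assume "is_cone J' C (relabel_func T) X q"
      then have "is_cone J C T X (\<lambda>j. q (i j))" unfolding relabel_cone .
      then have "\<exists>!h. h \<in> hom C X L \<and> (\<forall>j\<in>Ob J. Comp C (p (i j)) h = q (i j))"
        using L unfolding is_limit_def by blast
      then show "\<exists>!h. h \<in> hom C X L \<and> (\<forall>j\<in>Ob J'. Comp C (p j) h = q j)"
        by (simp add: relabel_simps)
    qed
  qed
qed

end

lemma relabel_small:
  assumes "category J" "small (U :: 'u itself) (Ob J)" "small U (Ar J)"
  obtains i :: "'j \<Rightarrow> 'u" and k :: "'k \<Rightarrow> 'u"
  where "relabelling J i k" "small_category U (relabel i k (J :: ('j, 'k) cat))"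
proof -
  obtain i :: "'j \<Rightarrow> 'u" where i: "inj_on i (Ob J)" using assms(2) by (rule small_copy)
  obtain k :: "'k \<Rightarrow> 'u" where k: "inj_on k (Ar J)" using assms(3) by (rule small_copy)
  interpret relabelling J i k
    using assms(1) i k by (simp add: relabelling_def relabelling_axioms_def)
  have "small_category U (relabel i k J)"
    unfolding small_category_def relabel_simps by (intro conjI relabel_category small_image assms)
  then show thesis using that relabelling_axioms by blast
qed

lemma complete_limit:
  assumes "complete (U :: 'u itself) C" "category J" "small U (Ob J)" "small U (Ar J)" "is_functor J C T"
  shows "\<exists>L p. is_limit J C T L p"
proof -
  obtain i k where ik: "relabelling J i k" "small_category U (relabel i k J)"
    using relabel_small[OF assms(2-4)] .
  interpret relabelling J i k by (rule ik)
  obtain L p where "is_limit J' C (relabel_func T) L p"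
    using assms(1) ik(2) relabel_functor[OF assms(5)] unfolding complete_def by blast
  then show ?thesis unfolding relabel_limit by blast
qed

text \<open>
  A compatible family of elements of the values of a diagram is a cone from a one-element set, so
  if the functor preserves the limit, the family comes from an element of the value at the limit.
  This is the only way in which preservation of limits is exploited below.
\<close>

lemma limit_element:
  fixes D :: "('o, 'a, 'x) set_func" and U :: "'u itself"
  assumes D: "is_functor C (set_cat U) D" "preserves_limits U C (set_cat U) D" and U: "universe U" and C: "category C"
    and J: "category J" "small U (Ob J)" "small U (Ar J)" and T: "is_functor J C T" and L: "is_limit J C T L p"
    and z: "\<And>j. j \<in> Ob J \<Longrightarrow> z j \<in> FOb D (FOb T j)"
    and comp: "\<And>f. f \<in> Ar J \<Longrightarrow> act D (FAr T f) (z (Dom J f)) = z (Cod J f)"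
  shows "\<exists>w\<in>FOb D L. \<forall>j\<in>Ob J. act D (p j) w = z j"
proof -
  interpret set_functor C U D using C D(1) by (simp add: set_functor_def set_functor_axioms_def)
  obtain i k where ik: "relabelling J i k" "small_category U (relabel i k J)"
    using relabel_small[OF J] .
  interpret relabelling J i k by (rule ik)
  let ?S = "set_cat U :: ('x set, 'x set_arrow) cat"
  have inv: "j \<in> Ob J \<Longrightarrow> inv_into (Ob J) i (i j) = j" for j by (simp add: inv_into_f_f[OF inj_i])
  \<comment> \<open>The hypothesis concerns diagrams in \<open>'u\<close>, so the limit is moved there and its image back.\<close>
  have "is_limit J' C (relabel_func T) L (\<lambda>j. p (inv_into (Ob J) i j))"
  proof -
    have "is_limit J C T L (\<lambda>j. p (inv_into (Ob J) i (i j)))"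
      using L unfolding is_limit_def is_cone_def by (simp add: inv J.dom_ob J.cod_ob)
    then show ?thesis unfolding relabel_limit .
  qed
  then have "is_limit J' ?S (comp_functor D (relabel_func T)) (FOb D L) (\<lambda>j. FAr D (p (inv_into (Ob J) i j)))"
    using D(2) ik(2) relabel_functor[OF T] unfolding preserves_limits_def by blast
  also have "comp_functor D (relabel_func T) = relabel_func (comp_functor D T)"
    by (simp add: comp_functor_def)
  finally have lim: "is_limit J ?S (comp_functor D T) (FOb D L) (\<lambda>j. FAr D (p (inv_into (Ob J) i (i j))))"
    unfolding relabel_limit .
  \<comment> \<open>A cone whose vertex is an arbitrary one-element set.\<close>
  let ?q = "\<lambda>j. SetArrow {undefined} (\<lambda>x\<in>{undefined}. z j) (FOb D (FOb T j))"
  have pt: "small U {undefined :: 'x}" by (rule small_finite[OF U]) simp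
  have TOb: "FOb T j \<in> Ob C" if "j \<in> Ob J" for j using T that unfolding is_functor_def by blast
  have q: "?q j \<in> hom ?S {undefined} (FOb D (FOb T j))" if "j \<in> Ob J" for j
    unfolding hom_set_cat using pt small_ob[OF TOb[OF that]] z[OF that] by auto
  have "is_cone J ?S (comp_functor D T) {undefined} ?q"
    unfolding is_cone_def
  proof (intro conjI ballI)
    show "{undefined} \<in> Ob ?S" using pt by (simp add: set_cat_Ob)
    show "?q j \<in> hom ?S {undefined} (FOb (comp_functor D T) j)" if "j \<in> Ob J" for j
      using q[OF that] by (simp add: comp_functor_def)
    fix f assume f: "f \<in> Ar J"
    have "FAr T f \<in> hom C (FOb T (Dom J f)) (FOb T (Cod J f))"
      by (rule functor_hom[OF T J(1) hom_Ar[OF f]])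
    from set_arrow[OF ar_hom[OF this]]
    show "Comp ?S (FAr (comp_functor D T) f) (?q (Dom J f)) = ?q (Cod J f)"
      using comp[OF f] by (simp add: comp_functor_def set_cat_comp fun_eq_iff)
  qed
  then obtain h where h: "h \<in> hom ?S {undefined} (FOb D L)"
    and eq: "\<forall>j\<in>Ob J. Comp ?S (FAr D (p (inv_into (Ob J) i (i j)))) h = ?q j"
    using lim unfolding is_limit_def by blast
  show ?thesis
  proof (intro bexI ballI)
    show "fn h undefined \<in> FOb D L" using set_arrow[OF h] by simp
    fix j assume j: "j \<in> Ob J"
    have "fn (Comp ?S (FAr D (p j)) h) undefined = fn (?q j) undefined" using eq j inv by simp
    then show "act D (p j) (fn h undefined) = z j" using set_arrow[OF h] by (simp add: set_cat_comp)
  qed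
qed

lemma hom_functor_simps:
  "FOb (hom_functor C A) X = hom C A X"
  "h \<in> hom C X Y \<Longrightarrow> g \<in> hom C A X \<Longrightarrow> act (hom_functor C A) h g = Comp C h g"
  by (auto simp: hom_functor_def hom_def)

lemma hom_functor_set_functor:
  assumes C: "category C" and "locally_small U C" "A \<in> Ob C"
  shows "set_functor C U (hom_functor C A)"
proof -
  interpret category C by (rule C)
  have sm: "small U (hom C A X)" if "X \<in> Ob C" for X using assms that unfolding locally_small_def by blast
  show ?thesis
  proof
    show "is_functor C (set_cat U) (hom_functor C A)" unfolding is_functor_def
    proof (intro conjI ballI impI)
      fix X assume X: "X \<in> Ob C"
      then show "FOb (hom_functor C A) X \<in> Ob (set_cat U)" by (simp add: hom_functor_def set_cat_Ob sm)
      have "Dom C (Id C X) = X" "Cod C (Id C X) = X" using id_hom[OF X] by (auto simp: hom_def)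
      then show "FAr (hom_functor C A) (Id C X) = Id (set_cat U) (FOb (hom_functor C A) X)"
        by (auto simp: hom_functor_def set_cat_def id_comp)
    next
      fix X Y h assume "h \<in> hom C X Y"
      then show "FAr (hom_functor C A) h \<in> hom (set_cat U) (FOb (hom_functor C A) X) (FOb (hom_functor C A) Y)"
        using hom_ob homD[of h C X Y] unfolding hom_set_cat by (auto simp: hom_functor_def sm comp_hom)
    next
      fix f g assume fg: "f \<in> Ar C" "g \<in> Ar C" "Cod C f = Dom C g"
      then have h: "f \<in> hom C (Dom C f) (Dom C g)" "g \<in> hom C (Dom C g) (Cod C g)" by (auto simp: hom_def)
      have gf: "Dom C (g \<cdot> f) = Dom C f" "Cod C (g \<cdot> f) = Cod C g" using homD[OF comp_hom[OF h]] by auto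
      show "FAr (hom_functor C A) (g \<cdot> f) = Comp (set_cat U) (FAr (hom_functor C A) g) (FAr (hom_functor C A) f)"
        using fg gf by (auto simp: hom_functor_def set_cat_comp comp_assoc[OF _ h] comp_hom[OF _ h(1)] intro!: restrict_ext)
    qed
  qed
qed

text \<open>
  A compatible family of elements in \<open>D\<close> of a diagram corresponds to a cone from the representing
  object, hence to an arrow into the limit. A map into the limit in sets is found pointwise in this
  way.
\<close>

lemma representable_preserves_limits:
  fixes D :: "('o, 'a, 'x) set_func" and U :: "'u itself"
  assumes D: "set_functor C U D" and rep: "representable C D"
  shows "preserves_limits U C (set_cat U) D"
  unfolding preserves_limits_def
proof (intro allI impI)
  interpret set_functor C U D by (rule D)
  let ?S = "set_cat U :: ('x set, 'x set_arrow) cat"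
  fix J :: "('u, 'u) cat" and T L p
  assume asm: "small_category U J \<and> is_functor J C T \<and> is_limit J C T L p"
  interpret J: category J using asm by (simp add: small_category_def)
  from rep obtain R t where R: "R \<in> Ob C" and t: "nat_trans C (hom_functor C R) D t"
    and bij: "\<And>A. A \<in> Ob C \<Longrightarrow> bij_betw (t A) (hom C R A) (FOb D A)"
    unfolding representable_def by blast
  have nat: "t B (h \<cdot> g) = act D h (t A g)" if "h \<in> hom C A B" "g \<in> hom C R A" for h g A B
    using t homD[OF that(1)] that(2) hom_functor_simps(2)[OF that] unfolding nat_trans_def hom_functor_simps(1) by metis
  have p: "p j \<in> hom C L (FOb T j)" if "j \<in> Ob J" for j
    using asm that unfolding is_limit_def is_cone_def by blast
  have pc: "FAr T k \<cdot> p (Dom J k) = p (Cod J k)" if "k \<in> Ar J" for k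
    using asm that unfolding is_limit_def is_cone_def by blast
  have L: "L \<in> Ob C" using asm unfolding is_limit_def is_cone_def by blast
  have TA: "FAr T k \<in> hom C (FOb T (Dom J k)) (FOb T (Cod J k))" if "k \<in> Ar J" for k
    using functor_hom[OF _ J.category_axioms hom_Ar[OF that]] asm by blast
  have TO: "FOb T j \<in> Ob C" if "j \<in> Ob J" for j using asm that unfolding is_functor_def by blast
  show "is_limit J ?S (comp_functor D T) (FOb D L) (\<lambda>j. FAr D (p j))"
    unfolding is_limit_def
  proof (intro conjI allI impI)
    show "is_cone J ?S (comp_functor D T) (FOb D L) (\<lambda>j. FAr D (p j))"
      unfolding is_cone_def
    proof (intro conjI ballI)
      show "FOb D L \<in> Ob ?S" using small_ob[OF L] by (simp add: set_cat_Ob)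
      show "FAr D (p j) \<in> hom ?S (FOb D L) (FOb (comp_functor D T) j)" if "j \<in> Ob J" for j
        using ar_hom[OF p[OF that]] by (simp add: comp_functor_def)
      fix k assume k: "k \<in> Ar J"
      have "FAr T k \<in> Ar C" "p (Dom J k) \<in> Ar C" "Cod C (p (Dom J k)) = Dom C (FAr T k)"
        using TA[OF k] p[OF J.dom_ob[OF k]] by (auto simp: hom_def)
      then have "FAr D (FAr T k \<cdot> p (Dom J k)) = Comp ?S (FAr D (FAr T k)) (FAr D (p (Dom J k)))"
        using is_fun unfolding is_functor_def by blast
      then show "Comp ?S (FAr (comp_functor D T) k) (FAr D (p (Dom J k))) = FAr D (p (Cod J k))"
        using pc[OF k] by (simp add: comp_functor_def)
    qed
  next
    fix X q assume cone: "is_cone J ?S (comp_functor D T) X q"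
    have X: "small U X" using cone unfolding is_cone_def set_cat_Ob by blast
    have q: "q j \<in> hom ?S X (FOb D (FOb T j))" if "j \<in> Ob J" for j
      using cone that unfolding is_cone_def comp_functor_def by simp
    have qc: "act D (FAr T k) (fn (q (Dom J k)) x) = fn (q (Cod J k)) x" if k: "k \<in> Ar J" and x: "x \<in> X" for k x
    proof -
      have "Comp ?S (FAr D (FAr T k)) (q (Dom J k)) = q (Cod J k)"
        using cone k unfolding is_cone_def comp_functor_def by simp
      then have "fn (Comp ?S (FAr D (FAr T k)) (q (Dom J k))) x = fn (q (Cod J k)) x" by simp
      then show ?thesis using set_arrow[OF q[OF J.dom_ob[OF k]]] x by (simp add: set_cat_comp)
    qed
    \<comment> \<open>The family \<open>r x\<close> is the cone from \<open>R\<close> that corresponds to the elements \<open>fn (q j) x\<close>.\<close>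
    define r where "r x j = inv_into (hom C R (FOb T j)) (t (FOb T j)) (fn (q j) x)" for x j
    have r: "r x j \<in> hom C R (FOb T j)" "t (FOb T j) (r x j) = fn (q j) x" if "j \<in> Ob J" "x \<in> X" for x j
    proof -
      have "fn (q j) x \<in> t (FOb T j) ` hom C R (FOb T j)"
        using bij[OF TO[OF that(1)]] set_arrow(3)[OF q] that unfolding bij_betw_def by blast
      then show "r x j \<in> hom C R (FOb T j)" "t (FOb T j) (r x j) = fn (q j) x"
        unfolding r_def by (rule inv_into_into, rule f_inv_into_f)
    qed
    have tinj: "g = g'" if "t A g = t A g'" "g \<in> hom C R A" "g' \<in> hom C R A" for A g g'
      using bij hom_ob that unfolding bij_betw_def inj_on_def by blast
    have "\<exists>!g. g \<in> hom C R L \<and> (\<forall>j\<in>Ob J. p j \<cdot> g = r x j)" if x: "x \<in> X" for x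
    proof -
      have "is_cone J C T R (r x)" unfolding is_cone_def
      proof (intro conjI ballI)
        fix k assume k: "k \<in> Ar J"
        show "FAr T k \<cdot> r x (Dom J k) = r x (Cod J k)"
        proof (rule tinj)
          show "t (FOb T (Cod J k)) (FAr T k \<cdot> r x (Dom J k)) = t (FOb T (Cod J k)) (r x (Cod J k))"
            using nat[OF TA[OF k] r(1)] r x qc[OF k x] J.dom_ob[OF k] J.cod_ob[OF k] by simp
        qed (use r x TA[OF k] comp_hom J.dom_ob[OF k] J.cod_ob[OF k] in blast)+
      qed (use R r x in auto)
      then show ?thesis using asm unfolding is_limit_def by blast
    qed
    then obtain g where g: "\<And>x. x \<in> X \<Longrightarrow> g x \<in> hom C R L"
      "\<And>x j. x \<in> X \<Longrightarrow> j \<in> Ob J \<Longrightarrow> p j \<cdot> g x = r x j"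
      and gu: "\<And>x g'. x \<in> X \<Longrightarrow> g' \<in> hom C R L \<Longrightarrow> (\<And>j. j \<in> Ob J \<Longrightarrow> p j \<cdot> g' = r x j) \<Longrightarrow> g' = g x"
      by metis
    have bL: "bij_betw (t L) (hom C R L) (FOb D L)" using bij[OF L] .
    have char: "act D (p j) (t L g') = fn (q j) x \<longleftrightarrow> p j \<cdot> g' = r x j"
      if "j \<in> Ob J" "x \<in> X" "g' \<in> hom C R L" for j x g'
      using nat[OF p[OF that(1)] that(3)] r[OF that(1,2)] tinj comp_hom[OF that(3) p[OF that(1)]] by metis
    let ?h = "SetArrow X (\<lambda>x\<in>X. t L (g x)) (FOb D L)"
    have h: "?h \<in> hom ?S X (FOb D L)"
      unfolding hom_set_cat using X small_ob[OF L] g(1) bL unfolding bij_betw_def by auto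
    show "\<exists>!h. h \<in> hom ?S X (FOb D L) \<and> (\<forall>j\<in>Ob J. Comp ?S (FAr D (p j)) h = q j)"
    proof (rule ex1I[of _ ?h], intro conjI ballI h)
      fix j assume j: "j \<in> Ob J"
      have pj: "FAr D (p j) \<in> hom ?S (FOb D L) (FOb D (FOb T j))" using ar_hom[OF p[OF j]] .
      show "Comp ?S (FAr D (p j)) ?h = q j"
      proof (rule set_arrow_eqI[OF _ q[OF j]])
        show "Comp ?S (FAr D (p j)) ?h \<in> hom ?S X (FOb D (FOb T j))"
          unfolding hom_set_cat set_cat_comp using X small_ob[OF TO[OF j]] set_arrow[OF pj] set_arrow(3)[OF h] by auto
        fix x assume x: "x \<in> X"
        show "fn (Comp ?S (FAr D (p j)) ?h) x = fn (q j) x"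
          using char[OF j x g(1)[OF x]] g(2)[OF x j] x by (simp add: set_cat_comp)
      qed
    next
      fix h assume hh: "h \<in> hom ?S X (FOb D L) \<and> (\<forall>j\<in>Ob J. Comp ?S (FAr D (p j)) h = q j)"
      show "h = ?h"
      proof (rule set_arrow_eqI[OF _ h])
        show h': "h \<in> hom ?S X (FOb D L)" using hh by blast
        fix x assume x: "x \<in> X"
        obtain g' where g': "g' \<in> hom C R L" "fn h x = t L g'"
          using set_arrow(3)[OF h' x] bL unfolding bij_betw_def by blast
        have "p j \<cdot> g' = r x j" if j: "j \<in> Ob J" for j
        proof -
          have "fn (Comp ?S (FAr D (p j)) h) x = fn (q j) x" using hh j by simp
          then have "act D (p j) (t L g') = fn (q j) x" using set_arrow[OF h'] x g'(2) by (simp add: set_cat_comp)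
          then show ?thesis using char[OF j x g'(1)] by simp
        qed
        then have "g' = g x" using gu[OF x g'(1)] by blast
        then show "fn h x = fn ?h x" using g' x by simp
      qed
    qed
  qed
qed

section \<open>Products, equalisers and intersections\<close>

text \<open>
  The shape with objects \<open>I\<close> and \<open>J\<close> and, apart from identities, an arrow from \<open>s e\<close> to \<open>t e\<close> for each
  \<open>e \<in> E\<close>. No two of these arrows are composable, so every choice of arrows is a diagram. Products,
  equalisers and intersections of subobjects are limits of this shape.
\<close>

definition bipartite :: "'x set \<Rightarrow> 'y set \<Rightarrow> 'z set \<Rightarrow> ('z \<Rightarrow> 'x) \<Rightarrow> ('z \<Rightarrow> 'y) \<Rightarrow> ('x + 'y, ('x + 'y) + 'z) cat" where
  "bipartite I J E s t =
     \<lparr>Ob = I <+> J, Ar = (I <+> J) <+> E,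
      Dom = case_sum id (\<lambda>e. Inl (s e)), Cod = case_sum id (\<lambda>e. Inr (t e)),
      Id = Inl, Comp = (\<lambda>g f. case g of Inl _ \<Rightarrow> f | Inr _ \<Rightarrow> g)\<rparr>"

lemma bipartite_category:
  assumes "\<And>e. e \<in> E \<Longrightarrow> s e \<in> I" "\<And>e. e \<in> E \<Longrightarrow> t e \<in> J"
  shows "category (bipartite I J E s t)"
  by unfold_locales (use assms in \<open>auto simp: bipartite_def hom_def\<close>)

locale complete_category = category C for C :: "('o, 'a) cat" +
  fixes U :: "'u itself"
  assumes univ: "universe U" and complete: "complete U C"
begin

definition continuous :: "('o, 'a, 'x) set_func \<Rightarrow> bool" where
  "continuous D \<longleftrightarrow> is_functor C (set_cat U) D \<and> preserves_limits U C (set_cat U) D"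

text \<open>
  The last conclusion is \<open>limit_element\<close> for a functor \<open>D\<close> that is fixed in advance; it accompanies
  the limit through the special cases below.
\<close>

lemma bipartite_limit:
  fixes I :: "'x set" and J :: "'y set" and E :: "'z set" and D :: "('o, 'a, 'w) set_func"
  assumes small: "small U I" "small U J" "small U E"
    and s: "\<And>e. e \<in> E \<Longrightarrow> s e \<in> I" and t: "\<And>e. e \<in> E \<Longrightarrow> t e \<in> J"
    and a: "\<And>i. i \<in> I \<Longrightarrow> a i \<in> Ob C" and b: "\<And>j. j \<in> J \<Longrightarrow> b j \<in> Ob C"
    and \<phi>: "\<And>e. e \<in> E \<Longrightarrow> \<phi> e \<in> hom C (a (s e)) (b (t e))"
  obtains L p q where "L \<in> Ob C" "\<And>i. i \<in> I \<Longrightarrow> p i \<in> hom C L (a i)" "\<And>j. j \<in> J \<Longrightarrow> q j \<in> hom C L (b j)"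
    "\<And>e. e \<in> E \<Longrightarrow> \<phi> e \<cdot> p (s e) = q (t e)"
    "\<And>X f g. X \<in> Ob C \<Longrightarrow> (\<And>i. i \<in> I \<Longrightarrow> f i \<in> hom C X (a i)) \<Longrightarrow> (\<And>j. j \<in> J \<Longrightarrow> g j \<in> hom C X (b j)) \<Longrightarrow>
       (\<And>e. e \<in> E \<Longrightarrow> \<phi> e \<cdot> f (s e) = g (t e)) \<Longrightarrow>
       \<exists>!h. h \<in> hom C X L \<and> (\<forall>i\<in>I. p i \<cdot> h = f i) \<and> (\<forall>j\<in>J. q j \<cdot> h = g j)"
    "\<And>x y. continuous D \<Longrightarrow> (\<And>i. i \<in> I \<Longrightarrow> x i \<in> FOb D (a i)) \<Longrightarrow> (\<And>j. j \<in> J \<Longrightarrow> y j \<in> FOb D (b j)) \<Longrightarrow>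
       (\<And>e. e \<in> E \<Longrightarrow> act D (\<phi> e) (x (s e)) = y (t e)) \<Longrightarrow>
       \<exists>z\<in>FOb D L. (\<forall>i\<in>I. act D (p i) z = x i) \<and> (\<forall>j\<in>J. act D (q j) z = y j)"
proof -
  let ?B = "bipartite I J E s t"
  define T :: "('x + 'y, ('x + 'y) + 'z, 'o, 'a) func" where
    "T = \<lparr>FOb = case_sum a b, FAr = case_sum (\<lambda>n. Id C (case_sum a b n)) \<phi>\<rparr>"
  interpret B: category ?B using s t by (rule bipartite_category)
  have T: "is_functor ?B C T" unfolding is_functor_def
  proof (intro conjI ballI impI)
    fix n assume "n \<in> Ob ?B"
    then show "FOb T n \<in> Ob C" "FAr T (Id ?B n) = Id C (FOb T n)"
      using a b by (auto simp: T_def bipartite_def)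
  next
    fix n n' f assume "f \<in> hom ?B n n'"
    then show "FAr T f \<in> hom C (FOb T n) (FOb T n')"
      using a b \<phi> id_hom by (auto simp: T_def bipartite_def hom_def)
  next
    fix f g assume "f \<in> Ar ?B" "g \<in> Ar ?B" "Cod ?B f = Dom ?B g"
    then show "FAr T (Comp ?B g f) = FAr T g \<cdot> FAr T f"
      using a b id_comp[OF id_hom] id_comp[OF \<phi>] comp_id[OF \<phi>]
      by (auto simp: T_def bipartite_def)
  qed
  have sB: "small U (Ob ?B)" "small U (Ar ?B)"
    unfolding bipartite_def by (auto intro!: small_Plus univ small)
  obtain L r where L: "is_limit ?B C T L r"
    using complete_limit[OF complete B.category_axioms sB T] by blast
  have r: "r n \<in> hom C L (case_sum a b n)" if "n \<in> I <+> J" for n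
    using L that unfolding is_limit_def is_cone_def by (simp add: T_def bipartite_def)
  have cone: "is_cone ?B C T X (case_sum f g)"
    if "X \<in> Ob C" "\<And>i. i \<in> I \<Longrightarrow> f i \<in> hom C X (a i)" "\<And>j. j \<in> J \<Longrightarrow> g j \<in> hom C X (b j)"
      "\<And>e. e \<in> E \<Longrightarrow> \<phi> e \<cdot> f (s e) = g (t e)" for X f g
    using that id_comp[OF that(2)] id_comp[OF that(3)] unfolding is_cone_def by (auto simp: T_def bipartite_def)
  show thesis
  proof (rule that[of L "\<lambda>i. r (Inl i)" "\<lambda>j. r (Inr j)"])
    show "L \<in> Ob C" using L unfolding is_limit_def is_cone_def by blast
    show "r (Inl i) \<in> hom C L (a i)" if "i \<in> I" for i using r[OF InlI[OF that]] by simp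
    show "r (Inr j) \<in> hom C L (b j)" if "j \<in> J" for j using r[OF InrI[OF that]] by simp
    show "\<phi> e \<cdot> r (Inl (s e)) = r (Inr (t e))" if "e \<in> E" for e
    proof -
      have "\<forall>k\<in>Ar ?B. FAr T k \<cdot> r (Dom ?B k) = r (Cod ?B k)"
        using L unfolding is_limit_def is_cone_def by blast
      moreover have "Inr e \<in> Ar ?B" using that by (simp add: bipartite_def InrI)
      ultimately have "FAr T (Inr e) \<cdot> r (Dom ?B (Inr e)) = r (Cod ?B (Inr e))" by blast
      then show ?thesis by (simp add: T_def bipartite_def)
    qed
    show "\<exists>!h. h \<in> hom C X L \<and> (\<forall>i\<in>I. r (Inl i) \<cdot> h = f i) \<and> (\<forall>j\<in>J. r (Inr j) \<cdot> h = g j)"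
      if "X \<in> Ob C" "\<And>i. i \<in> I \<Longrightarrow> f i \<in> hom C X (a i)" "\<And>j. j \<in> J \<Longrightarrow> g j \<in> hom C X (b j)"
      "\<And>e. e \<in> E \<Longrightarrow> \<phi> e \<cdot> f (s e) = g (t e)" for X f g
    proof -
      have "\<exists>!h. h \<in> hom C X L \<and> (\<forall>n\<in>Ob ?B. r n \<cdot> h = case_sum f g n)"
        using L cone[OF that] unfolding is_limit_def by blast
      then show ?thesis by (simp add: bipartite_def Plus_def ball_Un)
    qed
    show "\<exists>z\<in>FOb D L. (\<forall>i\<in>I. act D (r (Inl i)) z = x i) \<and> (\<forall>j\<in>J. act D (r (Inr j)) z = y j)"
      if D: "continuous D" and x: "\<And>i. i \<in> I \<Longrightarrow> x i \<in> FOb D (a i)" and y: "\<And>j. j \<in> J \<Longrightarrow> y j \<in> FOb D (b j)"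
      and xy: "\<And>e. e \<in> E \<Longrightarrow> act D (\<phi> e) (x (s e)) = y (t e)" for x y
    proof -
      interpret D: set_functor C U D using D by unfold_locales (simp add: continuous_def)
      have "\<exists>w\<in>FOb D L. \<forall>n\<in>Ob ?B. act D (r n) w = case_sum x y n"
      proof (rule limit_element[OF D.is_fun _ univ category_axioms B.category_axioms sB T L])
        show "preserves_limits U C (set_cat U) D" using D by (simp add: continuous_def)
        fix n assume "n \<in> Ob ?B"
        then show "case_sum x y n \<in> FOb D (FOb T n)" using x y by (auto simp: bipartite_def T_def)
      next
        fix f assume "f \<in> Ar ?B"
        then show "act D (FAr T f) (case_sum x y (Dom ?B f)) = case_sum x y (Cod ?B f)"
          using x y xy a b D.act_id by (auto simp: bipartite_def T_def)
      qed
      then show ?thesis by (simp add: bipartite_def Plus_def ball_Un)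
    qed
  qed
qed

text \<open>
  The shape with objects \<open>I\<close> and only identities, that is, \<open>J\<close> and \<open>E\<close> empty.
\<close>

lemma product:
  fixes I :: "'x set" and D :: "('o, 'a, 'w) set_func"
  assumes "small U I" "\<And>i. i \<in> I \<Longrightarrow> a i \<in> Ob C"
  obtains L p where "L \<in> Ob C" "\<And>i. i \<in> I \<Longrightarrow> p i \<in> hom C L (a i)"
    "\<forall>X\<in>Ob C. \<forall>f. (\<forall>i\<in>I. f i \<in> hom C X (a i)) \<longrightarrow>
       (\<exists>!h. h \<in> hom C X L \<and> (\<forall>i\<in>I. p i \<cdot> h = f i))"
    "\<And>x. continuous D \<Longrightarrow> (\<And>i. i \<in> I \<Longrightarrow> x i \<in> FOb D (a i)) \<Longrightarrow> \<exists>z\<in>FOb D L. \<forall>i\<in>I. act D (p i) z = x i"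
proof -
  let ?N = "{} :: unit set"
  have N: "small U ?N" by (rule small_finite[OF univ]) simp
  show thesis
  proof (rule bipartite_limit[of I ?N ?N undefined undefined a undefined undefined D thesis])
    fix L p q
    assume L: "L \<in> Ob C" "\<And>i. i \<in> I \<Longrightarrow> p i \<in> hom C L (a i)"
      and univ: "\<And>X f g. X \<in> Ob C \<Longrightarrow> (\<And>i. i \<in> I \<Longrightarrow> f i \<in> hom C X (a i)) \<Longrightarrow> (\<And>j. j \<in> ?N \<Longrightarrow> g j \<in> hom C X (undefined j)) \<Longrightarrow>
       (\<And>e. e \<in> ?N \<Longrightarrow> undefined e \<cdot> f (undefined e) = g (undefined e)) \<Longrightarrow>
       \<exists>!h. h \<in> hom C X L \<and> (\<forall>i\<in>I. p i \<cdot> h = f i) \<and> (\<forall>j\<in>?N. q j \<cdot> h = g j)"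
      and lift: "\<And>x y. continuous D \<Longrightarrow> (\<And>i. i \<in> I \<Longrightarrow> x i \<in> FOb D (a i)) \<Longrightarrow> (\<And>j. j \<in> ?N \<Longrightarrow> y j \<in> FOb D (undefined j)) \<Longrightarrow>
       (\<And>e. e \<in> ?N \<Longrightarrow> act D (undefined e) (x (undefined e)) = y (undefined e)) \<Longrightarrow>
       \<exists>z\<in>FOb D L. (\<forall>i\<in>I. act D (p i) z = x i) \<and> (\<forall>j\<in>?N. act D (q j) z = y j)"
    show thesis
    proof (rule that[OF L])
      show "\<forall>X\<in>Ob C. \<forall>f. (\<forall>i\<in>I. f i \<in> hom C X (a i)) \<longrightarrow>
          (\<exists>!h. h \<in> hom C X L \<and> (\<forall>i\<in>I. p i \<cdot> h = f i))"
        using univ[of _ _ undefined] by simp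
    next
      fix x assume x: "continuous D" "\<And>i. i \<in> I \<Longrightarrow> x i \<in> FOb D (a i)"
      show "\<exists>z\<in>FOb D L. \<forall>i\<in>I. act D (p i) z = x i"
        using lift[OF x, of undefined] by blast
    qed
  qed (use assms N in auto)
qed

text \<open>
  The parallel pair is indexed by \<open>bool\<close>.
\<close>

lemma equaliser:
  fixes D :: "('o, 'a, 'w) set_func"
  assumes h: "h \<in> hom C A B" and k: "k \<in> hom C A B"
  obtains E q where "q \<in> hom C E A" "is_equaliser C h k q"
    "\<And>x. continuous D \<Longrightarrow> x \<in> FOb D A \<Longrightarrow> act D h x = act D k x \<Longrightarrow> \<exists>y\<in>FOb D E. act D q y = x"
proof -
  have fin: "small U (UNIV :: unit set)" "small U (UNIV :: bool set)"
    by (rule small_finite[OF univ], simp)+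
  have ob: "A \<in> Ob C" "B \<in> Ob C" using h hom_ob by auto
  let ?\<phi> = "\<lambda>e. if e then h else k"
  show thesis
  proof (rule bipartite_limit[of "UNIV :: unit set" "UNIV :: unit set" "UNIV :: bool set" "\<lambda>_. ()" "\<lambda>_. ()"
        "\<lambda>_. A" "\<lambda>_. B" ?\<phi> D thesis])
    fix L p q
    assume L: "L \<in> Ob C" and p: "\<And>i. i \<in> UNIV \<Longrightarrow> p i \<in> hom C L A" and q: "\<And>j. j \<in> UNIV \<Longrightarrow> q j \<in> hom C L B"
      and pq: "\<And>e. e \<in> UNIV \<Longrightarrow> (if e then h else k) \<cdot> p () = q ()"
      and univ: "\<And>X f g. X \<in> Ob C \<Longrightarrow> (\<And>i. i \<in> UNIV \<Longrightarrow> f i \<in> hom C X A) \<Longrightarrow> (\<And>j. j \<in> UNIV \<Longrightarrow> g j \<in> hom C X B) \<Longrightarrow>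
       (\<And>e. e \<in> UNIV \<Longrightarrow> (if e then h else k) \<cdot> f () = g ()) \<Longrightarrow>
       \<exists>!h. h \<in> hom C X L \<and> (\<forall>i\<in>UNIV. p i \<cdot> h = f i) \<and> (\<forall>j\<in>UNIV. q j \<cdot> h = g j)"
      and lift: "\<And>x y. continuous D \<Longrightarrow> (\<And>i. i \<in> UNIV \<Longrightarrow> x i \<in> FOb D A) \<Longrightarrow> (\<And>j. j \<in> UNIV \<Longrightarrow> y j \<in> FOb D B) \<Longrightarrow>
       (\<And>e. e \<in> UNIV \<Longrightarrow> act D (if e then h else k) (x ()) = y ()) \<Longrightarrow>
       \<exists>z\<in>FOb D L. (\<forall>i\<in>UNIV. act D (p i) z = x i) \<and> (\<forall>j\<in>UNIV. act D (q j) z = y j)"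
    have p': "p () \<in> hom C L A" using p by simp
    have hp: "h \<cdot> p () = q ()" "k \<cdot> p () = q ()" using pq[of True] pq[of False] by auto
    show thesis
    proof (rule that[OF p'])
      have "\<exists>!j. j \<in> hom C X L \<and> p () \<cdot> j = f" if X: "X \<in> Ob C" and f: "f \<in> hom C X A" and e: "h \<cdot> f = k \<cdot> f" for X f
      proof -
        have q: "q () \<cdot> j = h \<cdot> f" if "j \<in> hom C X L" "p () \<cdot> j = f" for j
          using comp_assoc[OF that(1) p' h] hp that by simp
        have "\<exists>!j. j \<in> hom C X L \<and> (\<forall>i\<in>UNIV. p i \<cdot> j = f) \<and> (\<forall>i\<in>UNIV. q i \<cdot> j = h \<cdot> f)"
          by (rule univ[of X "\<lambda>_. f" "\<lambda>_. h \<cdot> f"]) (use X f e comp_hom[OF f h] in auto)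
        then show ?thesis using q by (auto simp: UNIV_unit)
      qed
      then show "is_equaliser C h k (p ())"
        unfolding is_equaliser_def using L ob p' h k hp by (intro bexI[of _ L] bexI[of _ A] bexI[of _ B]) auto
      fix x assume D: "continuous D" and x: "x \<in> FOb D A" "act D h x = act D k x"
      interpret D: set_functor C U D using D by unfold_locales (simp add: continuous_def)
      have "\<exists>z\<in>FOb D L. (\<forall>i\<in>UNIV. act D (p i) z = x) \<and> (\<forall>i\<in>UNIV. act D (q i) z = act D h x)"
        by (rule lift[of "\<lambda>_. x" "\<lambda>_. act D h x"]) (use D x D.act_in[OF h x(1)] in auto)
      then show "\<exists>y\<in>FOb D L. act D (p ()) y = x" by auto
    qed
  qed (use fin ob h k in auto)
qed

text \<open>
  The wide pullback of the monomorphisms in \<open>M\<close>. Its legs \<open>r m\<close> are determined by \<open>p\<close> because every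
  \<open>m\<close> is a monomorphism, so \<open>p\<close> is one as well. The object \<open>A\<close> belongs to the diagram, so that an empty
  \<open>M\<close> yields \<open>A\<close> itself.
\<close>

lemma intersection:
  fixes D :: "('o, 'a, 'w) set_func"
  assumes A: "A \<in> Ob C" and M: "small U M" "\<And>m. m \<in> M \<Longrightarrow> monomorphism C m \<and> Cod C m = A"
  obtains P p r where "p \<in> hom C P A" "monomorphism C p" "\<And>m. m \<in> M \<Longrightarrow> r m \<in> hom C P (Dom C m) \<and> m \<cdot> r m = p"
    "\<And>x. continuous D \<Longrightarrow> x \<in> FOb D A \<Longrightarrow> (\<And>m. m \<in> M \<Longrightarrow> \<exists>y\<in>FOb D (Dom C m). act D m y = x) \<Longrightarrow>
       \<exists>z\<in>FOb D P. act D p z = x"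
proof -
  have fin: "small U (UNIV :: unit set)" by (rule small_finite[OF univ]) simp
  have m: "m \<in> hom C (Dom C m) A" "Dom C m \<in> Ob C" if "m \<in> M" for m
    using M(2)[OF that] unfolding monomorphism_def by (auto simp: hom_def dom_ob)
  show thesis
  proof (rule bipartite_limit[of M "UNIV :: unit set" M id "\<lambda>_. ()" "Dom C" "\<lambda>_. A" id D thesis])
    fix L p q
    assume L: "L \<in> Ob C" and p: "\<And>i. i \<in> M \<Longrightarrow> p i \<in> hom C L (Dom C i)" and q: "\<And>j. j \<in> UNIV \<Longrightarrow> q j \<in> hom C L A"
      and pq: "\<And>e. e \<in> M \<Longrightarrow> id e \<cdot> p (id e) = q ()"
      and univ: "\<And>X f g. X \<in> Ob C \<Longrightarrow> (\<And>i. i \<in> M \<Longrightarrow> f i \<in> hom C X (Dom C i)) \<Longrightarrow> (\<And>j. j \<in> UNIV \<Longrightarrow> g j \<in> hom C X A) \<Longrightarrow>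
       (\<And>e. e \<in> M \<Longrightarrow> id e \<cdot> f (id e) = g ()) \<Longrightarrow>
       \<exists>!h. h \<in> hom C X L \<and> (\<forall>i\<in>M. p i \<cdot> h = f i) \<and> (\<forall>j\<in>UNIV. q j \<cdot> h = g j)"
      and lift: "\<And>x y. continuous D \<Longrightarrow> (\<And>i. i \<in> M \<Longrightarrow> x i \<in> FOb D (Dom C i)) \<Longrightarrow> (\<And>j. j \<in> UNIV \<Longrightarrow> y j \<in> FOb D A) \<Longrightarrow>
       (\<And>e. e \<in> M \<Longrightarrow> act D (id e) (x (id e)) = y ()) \<Longrightarrow>
       \<exists>z\<in>FOb D L. (\<forall>i\<in>M. act D (p i) z = x i) \<and> (\<forall>j\<in>UNIV. act D (q j) z = y j)"
    have q': "q () \<in> hom C L A" using q by simp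
    show thesis
    proof (rule that[OF q', of p])
      show "monomorphism C (q ())"
      proof (rule monoI[OF q'])
        fix X f g assume f: "f \<in> hom C X L" and g: "g \<in> hom C X L" and e: "q () \<cdot> f = q () \<cdot> g"
        have *: "m' \<cdot> (p m' \<cdot> f') = q () \<cdot> f'" if "m' \<in> M" "f' \<in> hom C X L" for m' f'
          using pq[OF that(1)] comp_assoc[OF that(2) p[OF that(1)] m(1)[OF that(1)]] by simp
        have pe: "p m' \<cdot> f = p m' \<cdot> g" if "m' \<in> M" for m'
          by (rule monoD[of m'])
            (use M(2)[OF that] m[OF that] *[OF that] e f g comp_hom[OF _ p[OF that]] in auto)
        have "\<exists>!h. h \<in> hom C X L \<and> (\<forall>i\<in>M. p i \<cdot> h = p i \<cdot> g) \<and> (\<forall>j\<in>UNIV. q j \<cdot> h = q () \<cdot> g)"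
        proof (rule univ)
          show "X \<in> Ob C" using hom_ob[OF g] by blast
          show "p i \<cdot> g \<in> hom C X (Dom C i)" if "i \<in> M" for i using comp_hom[OF g p[OF that]] .
          show "q () \<cdot> g \<in> hom C X A" by (rule comp_hom[OF g q'])
          show "id e \<cdot> (p (id e) \<cdot> g) = q () \<cdot> g" if "e \<in> M" for e using *[OF that g] by simp
        qed
        moreover have "f \<in> hom C X L \<and> (\<forall>i\<in>M. p i \<cdot> f = p i \<cdot> g) \<and> (\<forall>j\<in>UNIV. q j \<cdot> f = q () \<cdot> g)"
          using f pe e by simp
        moreover have "g \<in> hom C X L \<and> (\<forall>i\<in>M. p i \<cdot> g = p i \<cdot> g) \<and> (\<forall>j\<in>UNIV. q j \<cdot> g = q () \<cdot> g)"
          using g by simp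
        ultimately show "f = g" by (rule ex1_unique)
      qed
      show "p m' \<in> hom C L (Dom C m') \<and> m' \<cdot> p m' = q ()" if "m' \<in> M" for m'
        using p[OF that] pq[OF that] by simp
      fix x assume D: "continuous D" and x: "x \<in> FOb D A" and y: "\<And>m. m \<in> M \<Longrightarrow> \<exists>y\<in>FOb D (Dom C m). act D m y = x"
      from y obtain y where y: "\<And>m. m \<in> M \<Longrightarrow> y m \<in> FOb D (Dom C m) \<and> act D m (y m) = x" by metis
      have "\<exists>z\<in>FOb D L. (\<forall>i\<in>M. act D (p i) z = y i) \<and> (\<forall>i\<in>UNIV. act D (q i) z = x)"
        by (rule lift) (use D x y in auto)
      then show "\<exists>z\<in>FOb D L. act D (q ()) z = x" by auto
    qed
  qed (use fin m A M in auto)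
qed

end

section \<open>Extremal projective generators\<close>

locale projective_generator = complete_category C U for C :: "('o, 'a) cat" and U :: "'u itself" +
  fixes G :: 'o
  assumes loc_small: "locally_small U C" and generator: "extremal_projective_generator U C G"
begin

lemma gen_ob: "G \<in> Ob C"
  using generator by (simp add: extremal_projective_generator_def extremal_generator_def)

lemma small_hom: "A \<in> Ob C \<Longrightarrow> B \<in> Ob C \<Longrightarrow> small U (hom C A B)"
  using loc_small by (simp add: locally_small_def)

lemma copower_universal:
  assumes "is_copower C I G P inc" "X \<in> Ob C" "\<And>i. i \<in> I \<Longrightarrow> f i \<in> hom C G X"
  shows "\<exists>!h. h \<in> hom C P X \<and> (\<forall>i\<in>I. h \<cdot> inc i = f i)"
  using assms(1)[unfolded is_copower_def, THEN conjunct2, THEN conjunct2, THEN bspec, OF assms(2),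
      THEN spec, of f] assms(3) by blast

lemma copower_reindex:
  assumes k: "inj_on k I" and P: "is_copower C (k ` I) G P inc"
  shows "is_copower C I G P (\<lambda>i. inc (k i))"
  unfolding is_copower_def
proof (intro conjI ballI allI impI)
  show "P \<in> Ob C" using P unfolding is_copower_def by blast
  show "inc (k i) \<in> hom C G P" if "i \<in> I" for i using P that unfolding is_copower_def by auto
  fix X f assume X: "X \<in> Ob C" and f: "\<forall>i\<in>I. f i \<in> hom C G X"
  have "\<exists>!h. h \<in> hom C P X \<and> (\<forall>j\<in>k ` I. h \<cdot> inc j = f (inv_into I k j))"
    by (rule copower_universal[OF P X]) (use f k in auto)
  then show "\<exists>!h. h \<in> hom C P X \<and> (\<forall>i\<in>I. h \<cdot> inc (k i) = f i)" using k by simp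
qed

lemma canonical_arrow:
  assumes X: "X \<in> Ob C" and P: "is_copower C (hom C G X) G P inc"
  obtains c where "c \<in> hom C P X" "\<And>g. g \<in> hom C G X \<Longrightarrow> c \<cdot> inc g = g" "extremal_epi C c"
proof -
  obtain c where c: "c \<in> hom C P X" "\<forall>g\<in>hom C G X. c \<cdot> inc g = g"
    using copower_universal[OF P X, of "\<lambda>g. g"] by auto
  moreover have "extremal_epi C c"
    using generator X P c unfolding extremal_projective_generator_def extremal_generator_def by blast
  ultimately show thesis using that by blast
qed

text \<open>
  The definition of a generator provides copowers indexed by subsets of \<open>'u\<close>; a small set of any
  type is in bijection with one of these.
\<close>

lemma copower_exists:
  assumes "small U I"
  obtains P inc where "is_copower C I G P inc"
proof -
  obtain k :: "'b \<Rightarrow> 'u" where k: "inj_on k I" using assms by (rule small_copy)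
  have "small U (k ` I)" by (rule small_image[OF assms])
  then obtain P inc where "is_copower C (k ` I) G P inc"
    using generator unfolding extremal_projective_generator_def extremal_generator_def by blast
  from that[OF copower_reindex[OF k this]] show thesis .
qed

lemma copower_ext:
  assumes P: "is_copower C I G P inc" and h: "h \<in> hom C P X" "k \<in> hom C P X"
    and eq: "\<And>i. i \<in> I \<Longrightarrow> h \<cdot> inc i = k \<cdot> inc i"
  shows "h = k"
proof -
  have "k \<cdot> inc i \<in> hom C G X" if "i \<in> I" for i
    using P that comp_hom[OF _ h(2)] unfolding is_copower_def by blast
  then have "\<exists>!l. l \<in> hom C P X \<and> (\<forall>i\<in>I. l \<cdot> inc i = k \<cdot> inc i)"
    using hom_ob[OF h(2)] by (intro copower_universal[OF P]) auto
  then show ?thesis by (rule ex1_unique) (use h eq in auto)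
qed

text \<open>
  The canonical arrow onto \<open>X\<close> is an epimorphism, and two arrows that agree on all elements agree
  after composition with it.
\<close>

lemma generator_ext:
  assumes f: "f \<in> hom C X Y" and g: "g \<in> hom C X Y" and eq: "\<And>u. u \<in> hom C G X \<Longrightarrow> f \<cdot> u = g \<cdot> u"
  shows "f = g"
proof -
  have X: "X \<in> Ob C" using f hom_ob by blast
  obtain P inc where P: "is_copower C (hom C G X) G P inc"
    by (rule copower_exists[OF small_hom[OF gen_ob X]])
  obtain c where c: "c \<in> hom C P X" "\<And>g. g \<in> hom C G X \<Longrightarrow> c \<cdot> inc g = g" "extremal_epi C c"
    using canonical_arrow[OF X P] by blast
  have inc: "\<And>i. i \<in> hom C G X \<Longrightarrow> inc i \<in> hom C G P" using P unfolding is_copower_def by blast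
  have "f \<cdot> c = g \<cdot> c"
  proof (rule copower_ext[OF P comp_hom[OF c(1) f] comp_hom[OF c(1) g]])
    fix u assume u: "u \<in> hom C G X"
    show "(f \<cdot> c) \<cdot> inc u = (g \<cdot> c) \<cdot> inc u"
      using comp_assoc[OF inc[OF u] c(1) f] comp_assoc[OF inc[OF u] c(1) g] c(2)[OF u] eq[OF u] by simp
  qed
  then show ?thesis using epiD[OF _ c(1) f g] c(3) unfolding extremal_epi_def by blast
qed

text \<open>
  Suppose \<open>f = m k\<close> with \<open>m\<close> a monomorphism. Lifting every element of \<open>Y\<close> along \<open>f\<close> factors the canonical
  arrow onto \<open>Y\<close> through \<open>m\<close>, and that arrow is extremal.
\<close>

lemma surj_imp_extremal:
  assumes f: "f \<in> hom C X Y" and surj: "\<And>u. u \<in> hom C G Y \<Longrightarrow> \<exists>v\<in>hom C G X. f \<cdot> v = u"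
  shows "extremal_epi C f"
proof -
  have Y: "Y \<in> Ob C" using f hom_ob by blast
  have "epimorphism C f"
  proof (rule epiI[OF f])
    fix Z h k assume h: "h \<in> hom C Y Z" and k: "k \<in> hom C Y Z" and eq: "h \<cdot> f = k \<cdot> f"
    show "h = k"
    proof (rule generator_ext[OF h k])
      fix u assume "u \<in> hom C G Y"
      then obtain v where v: "v \<in> hom C G X" "f \<cdot> v = u" using surj by blast
      then show "h \<cdot> u = k \<cdot> u" using comp_assoc[OF v(1) f h] comp_assoc[OF v(1) f k] eq by simp
    qed
  qed
  moreover have "isomorphism C m" if k: "k \<in> Ar C" and mA: "m \<in> Ar C" and t: "Cod C k = Dom C m" "m \<cdot> k = f"
    and mono: "monomorphism C m" for k m
  proof -
    have k': "k \<in> hom C (Dom C k) (Dom C m)" and m': "m \<in> hom C (Dom C m) (Cod C m)"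
      using k mA t by (auto simp: hom_def)
    have "f \<in> hom C (Dom C k) (Cod C m)" using comp_hom[OF k' m'] t by simp
    then have dc: "Dom C k = X" "Cod C m = Y" using f by (auto simp: hom_def)
    note k' = k'[unfolded dc] and m' = m'[unfolded dc]
    obtain P inc where P: "is_copower C (hom C G Y) G P inc"
      by (rule copower_exists[OF small_hom[OF gen_ob Y]])
    obtain c where c: "c \<in> hom C P Y" "\<And>g. g \<in> hom C G Y \<Longrightarrow> c \<cdot> inc g = g" "extremal_epi C c"
      using canonical_arrow[OF Y P] by blast
    obtain v where v: "\<And>u. u \<in> hom C G Y \<Longrightarrow> v u \<in> hom C G X \<and> f \<cdot> v u = u" using surj by metis
    have "k \<cdot> v u \<in> hom C G (Dom C m)" if "u \<in> hom C G Y" for u using v[OF that] comp_hom[OF _ k'] by blast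
    then obtain d where d: "d \<in> hom C P (Dom C m)" "\<forall>u\<in>hom C G Y. d \<cdot> inc u = k \<cdot> v u"
      using copower_universal[OF P dom_ob[OF mA], of "\<lambda>u. k \<cdot> v u"] by auto
    have "m \<cdot> d = c"
    proof (rule copower_ext[OF P comp_hom[OF d(1) m'] c(1)])
      fix u assume u: "u \<in> hom C G Y"
      have i: "inc u \<in> hom C G P" using P u unfolding is_copower_def by blast
      have "(m \<cdot> d) \<cdot> inc u = m \<cdot> (k \<cdot> v u)" using comp_assoc[OF i d(1) m'] d(2) u by simp
      also have "\<dots> = u" using comp_assoc[OF _ k' m', of "v u" G] v[OF u] t(2) by simp
      finally show "(m \<cdot> d) \<cdot> inc u = c \<cdot> inc u" using c(2)[OF u] by simp
    qed
    from extremalD[OF c(3) d(1) m' this mono] show ?thesis .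
  qed
  ultimately show ?thesis unfolding extremal_epi_def by blast
qed

lemma mono_surj_iso:
  assumes m: "monomorphism C m" "m \<in> hom C X Y" and surj: "\<And>u. u \<in> hom C G Y \<Longrightarrow> \<exists>v\<in>hom C G X. m \<cdot> v = u"
  shows "isomorphism C m"
  using extremalD[OF surj_imp_extremal[OF m(2) surj] _ m(2) comp_id[OF m(2)] m(1)] id_hom hom_ob m(2) by blast

lemma projective_lift:
  assumes e: "extremal_epi C e" "e \<in> hom C X Y" and u: "u \<in> hom C G Y"
  obtains v where "v \<in> hom C G X" "e \<cdot> v = u"
proof -
  interpret V: set_functor C U "hom_functor C G"
    by (rule hom_functor_set_functor[OF category_axioms loc_small gen_ob])
  have "extremal_epi (set_cat U) (FAr (hom_functor C G) e)"
    using generator e(1) unfolding extremal_projective_generator_def extremal_projective_def by blast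
  from extremal_epi_set_cat_surj[OF this V.ar_hom[OF e(2)]]
  obtain v where "v \<in> hom C G X" "act (hom_functor C G) e v = u"
    using u unfolding hom_functor_simps by blast
  then show thesis using that e(2) by (simp add: hom_functor_simps)
qed

section \<open>Minimal subobjects supporting an element\<close>

text \<open>
  An element is minimal if it is not the image of an element of a proper subobject. For \<open>D = C(X,-)\<close>
  these are the extremal epimorphisms out of \<open>X\<close>.
\<close>

definition minimal :: "('o, 'a, 'x) set_func \<Rightarrow> 'o \<Rightarrow> 'x \<Rightarrow> bool" where
  "minimal D P x \<longleftrightarrow> x \<in> FOb D P \<and>
     (\<forall>Q q y. q \<in> hom C Q P \<and> monomorphism C q \<and> y \<in> FOb D Q \<and> act D q y = x \<longrightarrow> isomorphism C q)"

text \<open>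
  Intersect all subobjects of \<open>A\<close> on which \<open>x\<close> is defined. Preservation of this limit makes \<open>x\<close>
  defined on the intersection, and minimality holds by construction. The intersection has to be
  small, so only one monomorphism is kept for each image in \<open>V A\<close>. This suffices: a subobject of the
  intersection on which \<open>x\<close> is defined has the same image in \<open>V A\<close> as a monomorphism that was kept, and
  is therefore the whole intersection.
\<close>

lemma minimal_subobject:
  fixes D :: "('o, 'a, 'x) set_func"
  assumes D: "continuous D" and A: "A \<in> Ob C" and x: "x \<in> FOb D A"
  obtains P p e where "p \<in> hom C P A" "monomorphism C p" "minimal D P e" "act D p e = x"
proof -
  interpret D: set_functor C U D using D by unfold_locales (simp add: continuous_def)
  define K where "K = {m. monomorphism C m \<and> Cod C m = A \<and> (\<exists>y\<in>FOb D (Dom C m). act D m y = x)}"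
  define img where "img m = (\<lambda>u. m \<cdot> u) ` hom C G (Dom C m)" for m
  define rep where "rep S = (SOME m. m \<in> K \<and> img m = S)" for S
  have K_hom: "m \<in> hom C (Dom C m) A" if "m \<in> K" for m
    using that unfolding K_def monomorphism_def by (auto simp: hom_def)
  have rep: "rep (img m) \<in> K \<and> img (rep (img m)) = img m" if "m \<in> K" for m
    unfolding rep_def by (rule someI[of _ m]) (use that in blast)
  have "img ` K \<subseteq> Pow (hom C G A)" using K_hom comp_hom unfolding img_def by blast
  then have "small U (img ` K)"
    using small_Pow[OF univ small_hom[OF gen_ob A]] by (rule small_subset)
  then have N: "small U (rep ` img ` K)" by (rule small_image)
  have NK: "rep ` img ` K \<subseteq> K" using rep by blast
  obtain P p r where p: "p \<in> hom C P A" "monomorphism C p"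
    and r: "\<And>m. m \<in> rep ` img ` K \<Longrightarrow> r m \<in> hom C P (Dom C m) \<and> m \<cdot> r m = p"
    and lift: "\<And>x. continuous D \<Longrightarrow> x \<in> FOb D A \<Longrightarrow> (\<And>m. m \<in> rep ` img ` K \<Longrightarrow> \<exists>y\<in>FOb D (Dom C m). act D m y = x) \<Longrightarrow>
       \<exists>z\<in>FOb D P. act D p z = x"
  proof (rule intersection[OF A N, of D])
    show "monomorphism C m \<and> Cod C m = A" if "m \<in> rep ` img ` K" for m
      using subsetD[OF NK that] unfolding K_def by blast
  qed blast
  obtain e where e: "e \<in> FOb D P" "act D p e = x"
  proof -
    have "\<exists>y\<in>FOb D (Dom C m). act D m y = x" if "m \<in> rep ` img ` K" for m
      using subsetD[OF NK that] unfolding K_def by blast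
    then show thesis using lift[OF D x] that by blast
  qed
  have "isomorphism C q" if q: "q \<in> hom C Q P" "monomorphism C q" and y: "y \<in> FOb D Q" "act D q y = e" for Q q y
  proof -
    have pq: "p \<cdot> q \<in> hom C Q A" by (rule comp_hom[OF q(1) p(1)])
    then have dc: "Dom C (p \<cdot> q) = Q" "Cod C (p \<cdot> q) = A" by (auto simp: hom_def)
    have "act D (p \<cdot> q) y = x" using D.act_comp[OF q(1) p(1) y(1)] y(2) e(2) by simp
    then have "p \<cdot> q \<in> K" unfolding K_def using mono_comp[OF q(2,1) p(2,1)] dc y(1) by auto
    then have n: "rep (img (p \<cdot> q)) \<in> rep ` img ` K" "img (rep (img (p \<cdot> q))) = img (p \<cdot> q)"
      using rep by auto
    let ?n = "rep (img (p \<cdot> q))"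
    have nh: "?n \<in> hom C (Dom C ?n) A" and rn: "r ?n \<in> hom C P (Dom C ?n)" "?n \<cdot> r ?n = p"
      using n(1) NK K_hom r by auto
    show ?thesis
    proof (rule mono_surj_iso[OF q(2,1)])
      fix u assume u: "u \<in> hom C G P"
      \<comment> \<open>\<open>p\<close> factors through the representative \<open>?n\<close>, which has the same image as \<open>p \<cdot> q\<close>.\<close>
      have "?n \<cdot> (r ?n \<cdot> u) = p \<cdot> u" using comp_assoc[OF u rn(1) nh] rn(2) by simp
      moreover have "?n \<cdot> (r ?n \<cdot> u) \<in> img ?n"
        unfolding img_def[of ?n] by (rule imageI) (rule comp_hom[OF u rn(1)])
      ultimately have "p \<cdot> u \<in> img (p \<cdot> q)" unfolding n(2) by simp
      then obtain v where v: "v \<in> hom C G Q" "p \<cdot> u = (p \<cdot> q) \<cdot> v" unfolding img_def dc by blast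
      then have "p \<cdot> u = p \<cdot> (q \<cdot> v)" using comp_assoc[OF v(1) q(1) p(1)] by simp
      then have "u = q \<cdot> v" by (rule monoD[OF p(2,1) u comp_hom[OF v(1) q(1)]])
      then show "\<exists>v\<in>hom C G Q. q \<cdot> v = u" using v(1) by blast
    qed
  qed
  with e have "minimal D P e" unfolding minimal_def by blast
  with that p e(2) show thesis by blast
qed

text \<open>
  The equaliser of \<open>h\<close> and \<open>k\<close> is a subobject of \<open>P\<close> on which \<open>e\<close> is defined.
\<close>

lemma minimal_separates:
  fixes D :: "('o, 'a, 'x) set_func"
  assumes D: "continuous D" and e: "minimal D P e" and h: "h \<in> hom C P B" and k: "k \<in> hom C P B"
    and eq: "act D h e = act D k e"
  shows "h = k"
proof -
  obtain E q where q: "q \<in> hom C E P" "is_equaliser C h k q"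
    and lift: "\<And>x. continuous D \<Longrightarrow> x \<in> FOb D P \<Longrightarrow> act D h x = act D k x \<Longrightarrow> \<exists>y\<in>FOb D E. act D q y = x"
    using equaliser[OF h k, of D] by blast
  have "isomorphism C q"
    using e lift[OF D _ eq] equaliser_mono[OF q(2)] q(1) unfolding minimal_def by blast
  then obtain j where j: "j \<in> hom C P E" "q \<cdot> j = Id C P" using isoE q(1) by blast
  have "h \<cdot> q = k \<cdot> q" using q(2) unfolding is_equaliser_def by blast
  then have "h \<cdot> (q \<cdot> j) = k \<cdot> (q \<cdot> j)" using comp_assoc[OF j(1) q(1)] h k by simp
  then show ?thesis using j(2) comp_id h k by simp
qed

lemma hom_functor_continuous:
  assumes X: "X \<in> Ob C"
  shows "continuous (hom_functor C X)"
proof -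
  have V: "set_functor C U (hom_functor C X)"
    by (rule hom_functor_set_functor[OF category_axioms loc_small X])
  have "representable C (hom_functor C X)"
    unfolding representable_def nat_trans_def
    by (rule bexI[OF _ X], rule exI[of _ "\<lambda>_ g. g"]) (auto simp: hom_functor_simps bij_betw_def)
  from representable_preserves_limits[OF V this] show ?thesis
    using V unfolding continuous_def set_functor_def set_functor_axioms_def by blast
qed

text \<open>
  Take a minimal element of the functor \<open>C(X,-)\<close> below \<open>x\<close>.
\<close>

lemma factorisation:
  assumes x: "x \<in> hom C X A"
  obtains P p e where "e \<in> hom C X P" "extremal_epi C e" "p \<in> hom C P A" "monomorphism C p" "p \<cdot> e = x"
proof -
  have ob: "X \<in> Ob C" "A \<in> Ob C" using x hom_ob by auto
  note cont = hom_functor_continuous[OF ob(1)]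
  obtain P p e where p: "p \<in> hom C P A" "monomorphism C p" and m: "minimal (hom_functor C X) P e"
    and pe: "act (hom_functor C X) p e = x"
    using minimal_subobject[OF cont ob(2), unfolded hom_functor_simps(1), OF x] by blast
  have e: "e \<in> hom C X P" using m by (simp add: minimal_def hom_functor_simps)
  have "epimorphism C e"
    by (rule epiI[OF e], rule minimal_separates[OF cont m]) (simp_all add: hom_functor_simps e)
  moreover have "isomorphism C q" if k: "k \<in> Ar C" and qA: "q \<in> Ar C" and t: "Cod C k = Dom C q" "q \<cdot> k = e"
    and mono: "monomorphism C q" for k q
  proof -
    have k': "k \<in> hom C (Dom C k) (Dom C q)" and q': "q \<in> hom C (Dom C q) (Cod C q)"
      using k qA t by (auto simp: hom_def)
    have "e \<in> hom C (Dom C k) (Cod C q)" using comp_hom[OF k' q'] t by simp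
    then have dc: "Dom C k = X" "Cod C q = P" using e by (auto simp: hom_def)
    note k' = k'[unfolded dc] and q' = q'[unfolded dc]
    show ?thesis using m k' q' mono t(2) hom_functor_simps(2)[OF q' k']
      unfolding minimal_def hom_functor_simps(1) by blast
  qed
  ultimately have "extremal_epi C e" unfolding extremal_epi_def by blast
  with that e p pe show thesis by (auto simp: hom_functor_simps)
qed


section \<open>Partial operations as arrows\<close>

abbreviation V where "V \<equiv> hom_functor C G"

text \<open>
  With \<open>inc\<close> the injections of the \<open>I\<close>-fold copower \<open>P0\<close> of \<open>G\<close>, this is the bijection between the
  arrows from \<open>P0\<close> to \<open>A\<close> and the elements of \<open>V(A)\<^sup>I\<close>; it is natural in \<open>A\<close>.
\<close>

definition tuple :: "'i set \<Rightarrow> ('i \<Rightarrow> 'a) \<Rightarrow> 'a \<Rightarrow> 'i \<Rightarrow> 'a" where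
  "tuple I inc k = (\<lambda>i\<in>I. k \<cdot> inc i)"

lemma V_act: "h \<in> hom C A B \<Longrightarrow> u \<in> hom C G A \<Longrightarrow> act V h u = h \<cdot> u"
  by (rule hom_functor_simps)

lemma power_functor_simps:
  "FOb (power_functor C I V) A = I \<rightarrow>\<^sub>E hom C G A"
  "h \<in> hom C A B \<Longrightarrow> y \<in> I \<rightarrow>\<^sub>E hom C G A \<Longrightarrow> act (power_functor C I V) h y = (\<lambda>i\<in>I. h \<cdot> y i)"
  by (auto simp: power_functor_def hom_functor_simps(1) V_act homD PiE_mem[of _ I "\<lambda>_. hom C G A"] intro!: restrict_ext)

lemma subfunctor_set_functor: "subfunctor U C D F \<Longrightarrow> set_functor C U D"
  by unfold_locales (simp add: subfunctor_def)

lemma subfunctor_in: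
  "subfunctor U C D (power_functor C I V) \<Longrightarrow> A \<in> Ob C \<Longrightarrow> y \<in> FOb D A \<Longrightarrow> y \<in> I \<rightarrow>\<^sub>E hom C G A"
  unfolding subfunctor_def power_functor_simps(1) by blast

context
  fixes I :: "'i set" and P0 inc
  assumes P0: "is_copower C I G P0 inc"
begin

lemma inc_hom: "i \<in> I \<Longrightarrow> inc i \<in> hom C G P0"
  using P0 by (simp add: is_copower_def)

lemma P0_ob: "P0 \<in> Ob C"
  using P0 by (simp add: is_copower_def)

lemma tuple_in: "k \<in> hom C P0 A \<Longrightarrow> tuple I inc k \<in> I \<rightarrow>\<^sub>E hom C G A"
  unfolding tuple_def using comp_hom[OF inc_hom] by auto

lemma tuple_inj:
  assumes "k \<in> hom C P0 A" "l \<in> hom C P0 A" and eq: "tuple I inc k = tuple I inc l"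
  shows "k = l"
proof (rule copower_ext[OF P0 assms(1,2)])
  fix i assume "i \<in> I"
  then show "k \<cdot> inc i = l \<cdot> inc i" using fun_cong[OF eq, of i] by (simp add: tuple_def)
qed

lemma tuple_surj:
  assumes "A \<in> Ob C" "y \<in> I \<rightarrow>\<^sub>E hom C G A"
  obtains k where "k \<in> hom C P0 A" "y = tuple I inc k"
proof -
  obtain k where k: "k \<in> hom C P0 A" "\<forall>i\<in>I. k \<cdot> inc i = y i"
    using copower_universal[OF P0 assms(1), of y] assms(2) by blast
  have "y = tuple I inc k"
    by (rule PiE_ext[OF assms(2) tuple_in[OF k(1)]]) (use k(2) in \<open>simp add: tuple_def\<close>)
  with that k(1) show thesis by blast
qed

lemma act_tuple:
  assumes "h \<in> hom C A B" "k \<in> hom C P0 A"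
  shows "(\<lambda>i\<in>I. h \<cdot> tuple I inc k i) = tuple I inc (h \<cdot> k)"
  unfolding tuple_def by (rule restrict_ext) (simp add: comp_assoc[OF inc_hom assms(2,1)])

lemma subfunctor_act:
  assumes "subfunctor U C D (power_functor C I V)" "h \<in> hom C A B" "k \<in> hom C P0 A" "tuple I inc k \<in> FOb D A"
  shows "act D h (tuple I inc k) = tuple I inc (h \<cdot> k)"
proof -
  have "act D h (tuple I inc k) = act (power_functor C I V) h (tuple I inc k)"
    using assms homD[OF assms(2)] unfolding subfunctor_def by blast
  then show ?thesis
    using power_functor_simps(2)[OF assms(2) tuple_in[OF assms(3)]] act_tuple[OF assms(2,3)] by simp
qed

text \<open>
  By Yoneda a total operation is composition with an element \<open>u\<close> of \<open>V(P0)\<close>, its value at the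
  universal tuple. It extends \<open>f\<close> as soon as both agree at \<open>e\<close>, for \<open>e\<close> generates the domain, and the
  value of the total operation at \<open>e\<close> is \<open>e \<cdot> u\<close>.
\<close>

lemma extends_iff_factors:
  assumes op: "implicit_partial_operation U C V I D f" and e: "e \<in> hom C P0 R" "tuple I inc e \<in> FOb D R"
    and gen: "\<And>A y. A \<in> Ob C \<Longrightarrow> y \<in> FOb D A \<Longrightarrow> \<exists>h\<in>hom C R A. y = tuple I inc (h \<cdot> e)"
  shows "extends_to_total C V I D f \<longleftrightarrow> (\<exists>u\<in>hom C G P0. f R (tuple I inc e) = e \<cdot> u)"
proof
  have sub: "subfunctor U C D (power_functor C I V)" and nat: "nat_trans C D V f"
    using op by (auto simp: implicit_partial_operation_def)
  have R: "R \<in> Ob C" using e(1) hom_ob by blast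
  have id0: "Id C P0 \<in> hom C P0 P0" by (rule id_hom[OF P0_ob])
  {
    assume "extends_to_total C V I D f"
    then obtain g where g: "nat_trans C (power_functor C I V) V g"
      and ext: "\<forall>A\<in>Ob C. \<forall>x\<in>FOb D A. g A x = f A x"
      unfolding extends_to_total_def by blast
    \<comment> \<open>The universal tuple.\<close>
    let ?x = "tuple I inc (Id C P0)"
    have x: "?x \<in> FOb (power_functor C I V) P0" using tuple_in[OF id0] by (simp add: power_functor_simps)
    have u: "g P0 ?x \<in> hom C G P0"
      using g x P0_ob unfolding nat_trans_def hom_functor_simps(1) by blast
    have "g R (act (power_functor C I V) e ?x) = act V e (g P0 ?x)"
      using g x homD[OF e(1)] unfolding nat_trans_def by metis
    then have "g R (tuple I inc e) = e \<cdot> g P0 ?x"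
      using power_functor_simps(2)[OF e(1) tuple_in[OF id0]] act_tuple[OF e(1) id0] comp_id[OF e(1)] V_act[OF e(1) u]
      by simp
    then show "\<exists>u\<in>hom C G P0. f R (tuple I inc e) = e \<cdot> u" using ext R e(2) u by auto
  next
    assume "\<exists>u\<in>hom C G P0. f R (tuple I inc e) = e \<cdot> u"
    then obtain u where u: "u \<in> hom C G P0" "f R (tuple I inc e) = e \<cdot> u" by blast
    define g where "g A y = (THE k. k \<in> hom C P0 A \<and> tuple I inc k = y) \<cdot> u" for A y
    have g: "g A (tuple I inc k) = k \<cdot> u" if "k \<in> hom C P0 A" for A k
    proof -
      have "(THE l. l \<in> hom C P0 A \<and> tuple I inc l = tuple I inc k) = k"
        by (rule the_equality) (use that tuple_inj in blast)+
      then show ?thesis by (simp add: g_def)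
    qed
    have "nat_trans C (power_functor C I V) V g" unfolding nat_trans_def
    proof (intro conjI ballI)
      show "g A \<in> FOb (power_functor C I V) A \<rightarrow> FOb V A" if A: "A \<in> Ob C" for A
      proof
        fix y assume "y \<in> FOb (power_functor C I V) A"
        then obtain k where "k \<in> hom C P0 A" "y = tuple I inc k"
          using tuple_surj[OF A] unfolding power_functor_simps by blast
        then show "g A y \<in> FOb V A" using g comp_hom[OF u(1)] by (simp add: hom_functor_simps)
      qed
      fix h y assume h: "h \<in> Ar C" and y: "y \<in> FOb (power_functor C I V) (Dom C h)"
      note dom = dom_ob[OF h] and h = hom_Ar[OF h]
      obtain k where k: "k \<in> hom C P0 (Dom C h)" "y = tuple I inc k"
        using tuple_surj[OF dom] y unfolding power_functor_simps by blast
      have "act (power_functor C I V) h y = tuple I inc (h \<cdot> k)"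
        using power_functor_simps(2)[OF h, of y I] y act_tuple[OF h k(1)] k(2) by (simp add: power_functor_simps)
      then show "g (Cod C h) (act (power_functor C I V) h y) = act V h (g (Dom C h) y)"
        using g[OF k(1)] g[OF comp_hom[OF k(1) h]] k(2) V_act[OF h comp_hom[OF u(1) k(1)]]
          comp_assoc[OF u(1) k(1) h] by simp
    qed
    moreover have "g A y = f A y" if A: "A \<in> Ob C" and y: "y \<in> FOb D A" for A y
    proof -
      obtain h where h: "h \<in> hom C R A" "y = tuple I inc (h \<cdot> e)" using gen[OF A y] by blast
      have "f A (act D h (tuple I inc e)) = act V h (f R (tuple I inc e))"
        using nat homD[OF h(1)] e(2) unfolding nat_trans_def by metis
      then have "f A y = h \<cdot> (e \<cdot> u)"
        using subfunctor_act[OF sub h(1) e] V_act[OF h(1) comp_hom[OF u(1) e(1)]] u(2) h(2) by simp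
      then show ?thesis
        using g[OF comp_hom[OF e(1) h(1)]] comp_assoc[OF u(1) e(1) h(1)] h(2) by simp
    qed
    ultimately show "extends_to_total C V I D f" unfolding extends_to_total_def by blast
  }
qed

text \<open>
  The domain is the set of multiples of \<open>e\<close>, and the operation maps \<open>h \<cdot> e\<close> to \<open>h \<cdot> u\<close>; the condition
  on \<open>u\<close> makes it well defined. If \<open>e\<close> is an epimorphism, \<open>h\<close> is determined by \<open>h \<cdot> e\<close>, so \<open>B\<close>
  represents the domain.
\<close>

lemma principal_operation:
  assumes e: "e \<in> hom C P0 B" and u: "u \<in> hom C G B"
    and coh: "\<forall>X. \<forall>h\<in>hom C B X. \<forall>k\<in>hom C B X. h \<cdot> e = k \<cdot> e \<longrightarrow> h \<cdot> u = k \<cdot> u"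
  obtains D f where "implicit_partial_operation U C V I D f"
    "principal_subfunctor U C D (power_functor C I V)"
    "epimorphism C e \<Longrightarrow> representable C D"
    "extends_to_total C V I D f \<longleftrightarrow> (\<exists>v\<in>hom C G P0. u = e \<cdot> v)"
proof -
  have B: "B \<in> Ob C" using e hom_ob by blast
  define S where "S A = (\<lambda>h. tuple I inc (h \<cdot> e)) ` hom C B A" for A
  define D :: "('o, 'a, 'i \<Rightarrow> 'a) set_func" where
    "D = \<lparr>FOb = S, FAr = (\<lambda>h. SetArrow (S (Dom C h)) (\<lambda>y\<in>S (Dom C h). \<lambda>i\<in>I. h \<cdot> y i) (S (Cod C h)))\<rparr>"
  have sm: "small U (S A)" if "A \<in> Ob C" for A
    unfolding S_def by (rule small_image[OF small_hom[OF B that]])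
  have he: "h \<cdot> e \<in> hom C P0 A" if "h \<in> hom C B A" for h A by (rule comp_hom[OF e that])
  have S: "S A \<subseteq> I \<rightarrow>\<^sub>E hom C G A" for A unfolding S_def using tuple_in[OF he] by blast
  have actS: "(\<lambda>i\<in>I. h \<cdot> tuple I inc (k \<cdot> e) i) = tuple I inc ((h \<cdot> k) \<cdot> e)"
    if "h \<in> hom C A A'" "k \<in> hom C B A" for h k A A'
    using act_tuple[OF that(1) he[OF that(2)]] comp_assoc[OF e that(2,1)] by simp
  have closed: "(\<lambda>i\<in>I. h \<cdot> y i) \<in> S A'" if h: "h \<in> hom C A A'" and y: "y \<in> S A" for h y A A'
  proof -
    obtain k where k: "k \<in> hom C B A" "y = tuple I inc (k \<cdot> e)" using y unfolding S_def by blast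
    then have "(\<lambda>i\<in>I. h \<cdot> y i) = tuple I inc ((h \<cdot> k) \<cdot> e)" using actS[OF h] by simp
    then show ?thesis unfolding S_def using comp_hom[OF k(1) h] by blast
  qed
  have actD: "act D h y = (\<lambda>i\<in>I. h \<cdot> y i)" if "h \<in> hom C A A'" "y \<in> S A" for h y A A'
    using that homD[OF that(1)] by (simp add: D_def)
  have mem: "y i \<in> hom C G A" if "y \<in> S A" "i \<in> I" for y i A using S that by blast
  have "is_functor C (set_cat U) D" unfolding is_functor_def
  proof (intro conjI ballI impI)
    fix A assume A: "A \<in> Ob C"
    then show "FOb D A \<in> Ob (set_cat U)" by (simp add: D_def set_cat_Ob sm)
    have d: "Dom C (Id C A) = A" "Cod C (Id C A) = A" using homD[OF id_hom[OF A]] by auto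
    have "(\<lambda>i\<in>I. Id C A \<cdot> y i) = y" if y: "y \<in> S A" for y
    proof (rule PiE_ext[of _ I "\<lambda>_. hom C G A"])
      show "(\<lambda>i\<in>I. Id C A \<cdot> y i) \<in> I \<rightarrow>\<^sub>E hom C G A" "y \<in> I \<rightarrow>\<^sub>E hom C G A"
        using closed[OF id_hom[OF A] y] y S by blast+
      show "(\<lambda>i\<in>I. Id C A \<cdot> y i) i = y i" if "i \<in> I" for i
        using id_comp[OF mem[OF y that]] that by simp
    qed
    then show "FAr D (Id C A) = Id (set_cat U) (FOb D A)"
      by (auto simp: D_def set_cat_def d intro!: restrict_ext)
  next
    fix A A' h assume h: "h \<in> hom C A A'"
    then show "FAr D h \<in> hom (set_cat U) (FOb D A) (FOb D A')"
      using hom_ob[OF h] homD[OF h] closed[OF h] sm unfolding hom_set_cat by (auto simp: D_def)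
  next
    fix h k assume hk: "h \<in> Ar C" "k \<in> Ar C" "Cod C h = Dom C k"
    then have h: "h \<in> hom C (Dom C h) (Dom C k)" and k: "k \<in> hom C (Dom C k) (Cod C k)" by (auto simp: hom_def)
    have d: "Dom C (k \<cdot> h) = Dom C h" "Cod C (k \<cdot> h) = Cod C k" using homD[OF comp_hom[OF h k]] by auto
    have "(\<lambda>i\<in>I. (k \<cdot> h) \<cdot> y i) = (\<lambda>i\<in>I. k \<cdot> (\<lambda>i\<in>I. h \<cdot> y i) i)" if "y \<in> S (Dom C h)" for y
      by (rule restrict_ext) (simp add: comp_assoc[OF mem[OF that] h k])
    then show "FAr D (k \<cdot> h) = Comp (set_cat U) (FAr D k) (FAr D h)"
      using closed[OF h] hk(3) by (auto simp: D_def d set_cat_comp intro!: restrict_ext)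
  qed
  then have sub: "subfunctor U C D (power_functor C I V)"
    unfolding subfunctor_def
  proof (intro conjI ballI)
    show "FOb D A \<subseteq> FOb (power_functor C I V) A" for A using S by (simp add: D_def power_functor_simps)
    fix h y assume "h \<in> Ar C" and y: "y \<in> FOb D (Dom C h)"
    then have h: "h \<in> hom C (Dom C h) (Cod C h)" by (simp add: hom_Ar)
    have y': "y \<in> S (Dom C h)" using y by (simp add: D_def)
    show "act D h y = act (power_functor C I V) h y"
      using actD[OF h y'] power_functor_simps(2)[OF h subsetD[OF S y']] by simp
  qed
  define f where "f A y = (SOME h. h \<in> hom C B A \<and> tuple I inc (h \<cdot> e) = y) \<cdot> u" for A y
  have f: "f A (tuple I inc (h \<cdot> e)) = h \<cdot> u" if h: "h \<in> hom C B A" for A h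
  proof -
    let ?k = "SOME k. k \<in> hom C B A \<and> tuple I inc (k \<cdot> e) = tuple I inc (h \<cdot> e)"
    have k: "?k \<in> hom C B A \<and> tuple I inc (?k \<cdot> e) = tuple I inc (h \<cdot> e)"
      by (rule someI[of _ h]) (use h in blast)
    then have "?k \<cdot> e = h \<cdot> e" using tuple_inj he h by blast
    then show ?thesis using coh k h unfolding f_def by blast
  qed
  have nat: "nat_trans C D V f" unfolding nat_trans_def
  proof (intro conjI ballI)
    show "f A \<in> FOb D A \<rightarrow> FOb V A" for A
      using f comp_hom[OF u] by (auto simp: D_def S_def hom_functor_simps)
    fix h y assume h: "h \<in> Ar C" and y: "y \<in> FOb D (Dom C h)"
    note h = hom_Ar[OF h]
    obtain k where k: "k \<in> hom C B (Dom C h)" "y = tuple I inc (k \<cdot> e)"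
      using y by (auto simp: D_def S_def)
    have "act D h y = tuple I inc ((h \<cdot> k) \<cdot> e)"
      using actD[OF h, of y] actS[OF h k(1)] y k(2) by (simp add: D_def)
    then show "f (Cod C h) (act D h y) = act V h (f (Dom C h) y)"
      using f[OF k(1)] f[OF comp_hom[OF k(1) h]] k(2) V_act[OF h comp_hom[OF u k(1)]] comp_assoc[OF u k(1) h] by simp
  qed
  have op: "implicit_partial_operation U C V I D f"
    using sub nat by (simp add: implicit_partial_operation_def)
  have eS: "tuple I inc e \<in> S B" unfolding S_def using id_hom[OF B] id_comp[OF e] by force
  show thesis
  proof (rule that[OF op])
    have "FOb D A = {act (power_functor C I V) h (tuple I inc e) |h. h \<in> hom C B A}" for A
    proof -
      have "act (power_functor C I V) h (tuple I inc e) = tuple I inc (h \<cdot> e)" if "h \<in> hom C B A" for h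
        using power_functor_simps(2)[OF that tuple_in[OF e]] act_tuple[OF that e] by simp
      then show ?thesis unfolding D_def S_def by (simp add: image_def) (metis (no_types, lifting))
    qed
    then show "principal_subfunctor U C D (power_functor C I V)"
      unfolding principal_subfunctor_def using sub B tuple_in[OF e] unfolding power_functor_simps(1) by blast
    show "representable C D" if epi: "epimorphism C e"
      unfolding representable_def
    proof (intro bexI[OF _ B] exI[of _ "\<lambda>A h. tuple I inc (h \<cdot> e)"] conjI ballI)
      show "nat_trans C (hom_functor C B) D (\<lambda>A h. tuple I inc (h \<cdot> e))"
        unfolding nat_trans_def
      proof (intro conjI ballI)
        show "(\<lambda>h. tuple I inc (h \<cdot> e)) \<in> FOb (hom_functor C B) A \<rightarrow> FOb D A" for A
          by (auto simp: D_def S_def hom_functor_simps)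
        fix h k assume h: "h \<in> Ar C" and k: "k \<in> FOb (hom_functor C B) (Dom C h)"
        note h = hom_Ar[OF h] and k = k[unfolded hom_functor_simps(1)]
        have "tuple I inc (k \<cdot> e) \<in> S (Dom C h)" unfolding S_def using k by blast
        then show "tuple I inc (act (hom_functor C B) h k \<cdot> e) = act D h (tuple I inc (k \<cdot> e))"
          using actD[OF h] actS[OF h k] hom_functor_simps(2)[OF h k] by simp
      qed
      show "bij_betw (\<lambda>h. tuple I inc (h \<cdot> e)) (hom C B A) (FOb D A)" for A
        unfolding bij_betw_def
      proof
        show "inj_on (\<lambda>h. tuple I inc (h \<cdot> e)) (hom C B A)"
          by (rule inj_onI) (use tuple_inj he epiD[OF epi e] in blast)
        show "(\<lambda>h. tuple I inc (h \<cdot> e)) ` hom C B A = FOb D A" by (simp add: D_def S_def)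
      qed
    qed
    have "extends_to_total C V I D f \<longleftrightarrow> (\<exists>v\<in>hom C G P0. f B (tuple I inc e) = e \<cdot> v)"
      by (rule extends_iff_factors[OF op e]) (use eS in \<open>auto simp: D_def S_def\<close>)
    moreover have "f B (tuple I inc e) = u"
      using f[OF id_hom[OF B]] id_comp[OF e] id_comp[OF u] by simp
    ultimately show "extends_to_total C V I D f \<longleftrightarrow> (\<exists>v\<in>hom C G P0. u = e \<cdot> v)" by simp
  qed
qed

end


section \<open>Extending partial operations\<close>

text \<open>
  The arrow \<open>e\<close> is the universal element of \<open>D\<close>. It is an epimorphism because \<open>h\<close> is determined by the
  element \<open>h \<cdot> e\<close> that it represents.
\<close>

lemma representable_generated:
  assumes P0: "is_copower C I G P0 inc" and sub: "subfunctor U C D (power_functor C I V)" and rep: "representable C D"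
  obtains R e where "e \<in> hom C P0 R" "epimorphism C e" "tuple I inc e \<in> FOb D R"
    "\<And>A y. A \<in> Ob C \<Longrightarrow> y \<in> FOb D A \<Longrightarrow> \<exists>h\<in>hom C R A. y = tuple I inc (h \<cdot> e)"
proof -
  obtain R t where R: "R \<in> Ob C" and t: "nat_trans C (hom_functor C R) D t"
    and bij: "\<And>A. A \<in> Ob C \<Longrightarrow> bij_betw (t A) (hom C R A) (FOb D A)"
    using rep unfolding representable_def by blast
  have idR: "Id C R \<in> hom C R R" by (rule id_hom[OF R])
  have tid: "t R (Id C R) \<in> FOb D R" using bij[OF R] idR unfolding bij_betw_def by blast
  obtain e where e: "e \<in> hom C P0 R" "t R (Id C R) = tuple I inc e"
    by (rule tuple_surj[OF P0 R subfunctor_in[OF sub R tid]])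
  note eD = tid[unfolded e(2)]
  have th: "t A h = tuple I inc (h \<cdot> e)" if h: "h \<in> hom C R A" for h A
  proof -
    have "t A (act (hom_functor C R) h (Id C R)) = act D h (t R (Id C R))"
      using t homD[OF h] idR unfolding nat_trans_def hom_functor_simps(1) by metis
    then show ?thesis
      using hom_functor_simps(2)[OF h idR] comp_id[OF h] e(2) subfunctor_act[OF P0 sub h e(1) eD] by simp
  qed
  have "epimorphism C e"
  proof (rule epiI[OF e(1)])
    fix X h k assume h: "h \<in> hom C R X" and k: "k \<in> hom C R X" and "h \<cdot> e = k \<cdot> e"
    then have "t X h = t X k" using th by simp
    then show "h = k" using bij[of X] hom_ob[OF h] h k unfolding bij_betw_def inj_on_def by blast
  qed
  moreover have "\<exists>h\<in>hom C R A. y = tuple I inc (h \<cdot> e)" if "A \<in> Ob C" "y \<in> FOb D A" for A y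
  proof -
    have "y \<in> t A ` hom C R A" using bij[OF that(1)] that(2) by (simp add: bij_betw_def)
    then show ?thesis using th by blast
  qed
  ultimately show thesis using that e(1) eD by blast
qed

text \<open>
  Under ES the epimorphism that generates the domain is extremal, and the value of \<open>f\<close> at it lifts by
  projectivity.
\<close>

lemma ES_imp_representable_extends:
  assumes ES: "ES C" and I: "small U I" and op: "implicit_partial_operation U C V I D f" and rep: "representable C D"
  shows "extends_to_total C V I D f"
proof -
  obtain P0 inc where P0: "is_copower C I G P0 inc" by (rule copower_exists[OF I])
  have sub: "subfunctor U C D (power_functor C I V)" and nat: "nat_trans C D V f"
    using op by (auto simp: implicit_partial_operation_def)
  obtain R e where e: "e \<in> hom C P0 R" "epimorphism C e" "tuple I inc e \<in> FOb D R"
    and gen: "\<And>A y. A \<in> Ob C \<Longrightarrow> y \<in> FOb D A \<Longrightarrow> \<exists>h\<in>hom C R A. y = tuple I inc (h \<cdot> e)"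
    by (rule representable_generated[OF P0 sub rep]) (rule that)
  have R: "R \<in> Ob C" using hom_ob e(1) by blast
  have u: "f R (tuple I inc e) \<in> hom C G R"
    using nat R e(3) unfolding nat_trans_def hom_functor_simps(1) by blast
  have "extremal_epi C e" using ES e(2) by (simp add: ES_def)
  then obtain v where v: "v \<in> hom C G P0" "e \<cdot> v = f R (tuple I inc e)" using projective_lift[OF _ e(1) u] by blast
  then show ?thesis using extends_iff_factors[OF P0 op e(1,3) gen] v(2)[symmetric] by blast
qed

text \<open>
  Operations have arities in \<open>'u\<close>, so the copower over \<open>C(G,X)\<close> is reindexed by a subset of \<open>'u\<close>.
\<close>

lemma canonical_cover:
  assumes X: "X \<in> Ob C"
  obtains I :: "'u set" and P inc c where "small U I" "is_copower C I G P inc" "c \<in> hom C P X" "extremal_epi C c"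
proof -
  have sm: "small U (hom C G X)" by (rule small_hom[OF gen_ob X])
  obtain k :: "'a \<Rightarrow> 'u" where k: "inj_on k (hom C G X)" using sm by (rule small_copy)
  have I: "small U (k ` hom C G X)" by (rule small_image[OF sm])
  obtain P inc where P: "is_copower C (k ` hom C G X) G P inc" by (rule copower_exists[OF I])
  show thesis by (rule canonical_arrow[OF X copower_reindex[OF k P]]) (rule that[OF I P])
qed

text \<open>
  For a monomorphism \<open>m\<close> that is an epimorphism and a cover \<open>c\<close> of its domain, \<open>m \<cdot> c\<close> is an
  epimorphism. Every element \<open>u\<close> of the codomain of \<open>m\<close> is therefore the value at \<open>m \<cdot> c\<close> of an
  operation with representable domain. Extending it factors \<open>u\<close> through \<open>m\<close>.
\<close>

lemma representable_extends_imp_ES: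
  assumes ext: "\<And>(I :: 'u set) D f. small U I \<Longrightarrow> implicit_partial_operation U C V I D f \<Longrightarrow> representable C D \<Longrightarrow>
     extends_to_total C V I D f"
  shows "ES C"
  unfolding ES_iff_balanced
proof (intro allI impI)
  fix m assume bi: "monomorphism C m \<and> epimorphism C m"
  obtain A B where m: "m \<in> hom C A B" "monomorphism C m" "epimorphism C m"
    using mono_hom[of m] bi by blast
  have A: "A \<in> Ob C" using m(1) hom_ob by blast
  obtain I :: "'u set" and P inc c where I: "small U I" and P: "is_copower C I G P inc"
    and c: "c \<in> hom C P A" "extremal_epi C c" by (rule canonical_cover[OF A])
  have e: "m \<cdot> c \<in> hom C P B" by (rule comp_hom[OF c(1) m(1)])
  have epi: "epimorphism C (m \<cdot> c)"
    by (rule epi_comp[OF _ c(1) m(3,1)]) (use c(2) in \<open>simp add: extremal_epi_def\<close>)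
  show "isomorphism C m"
  proof (rule mono_surj_iso[OF m(2,1)])
    fix u assume u: "u \<in> hom C G B"
    have coh: "\<forall>X. \<forall>h\<in>hom C B X. \<forall>k\<in>hom C B X. h \<cdot> m \<cdot> c = k \<cdot> m \<cdot> c \<longrightarrow> h \<cdot> u = k \<cdot> u"
      using epiD[OF epi e] by blast
    obtain D f where "implicit_partial_operation U C V I D f" "representable C D"
      and iff: "extends_to_total C V I D f \<longleftrightarrow> (\<exists>v\<in>hom C G P. u = (m \<cdot> c) \<cdot> v)"
      using principal_operation[OF P e u coh] epi by blast
    then obtain v where v: "v \<in> hom C G P" "u = (m \<cdot> c) \<cdot> v" using ext[OF I] by blast
    then have "m \<cdot> (c \<cdot> v) = u" using comp_assoc[OF v(1) c(1) m(1)] by simp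
    then show "\<exists>v\<in>hom C G A. m \<cdot> v = u" using comp_hom[OF v(1) c(1)] by blast
  qed
qed

text \<open>
  Let \<open>u\<close> be the value of \<open>f\<close> at the generator \<open>e = p \<cdot> e'\<close>, where \<open>e'\<close> is an extremal epimorphism and \<open>p\<close>
  is the equaliser of \<open>h\<close> and \<open>k\<close>. Since \<open>h \<cdot> e = k \<cdot> e\<close>, naturality gives \<open>h \<cdot> u = k \<cdot> u\<close>. So \<open>u\<close> factors
  through \<open>p\<close>, and by projectivity through \<open>e'\<close>.
\<close>

lemma SES_imp_principal_extends:
  assumes SES: "SES C" and I: "small U I" and op: "implicit_partial_operation U C V I D f"
    and prin: "principal_subfunctor U C D (power_functor C I V)"
  shows "extends_to_total C V I D f"
proof -
  obtain P0 inc where P0: "is_copower C I G P0 inc" by (rule copower_exists[OF I])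
  have sub: "subfunctor U C D (power_functor C I V)" and nat: "nat_trans C D V f"
    using op by (auto simp: implicit_partial_operation_def)
  obtain A x where A: "A \<in> Ob C" and x: "x \<in> FOb (power_functor C I V) A"
    and "\<forall>B\<in>Ob C. FOb D B = {act (power_functor C I V) h x |h. h \<in> hom C A B}"
    using prin unfolding principal_subfunctor_def by blast
  then have D: "FOb D B = {act (power_functor C I V) h x |h. h \<in> hom C A B}" if "B \<in> Ob C" for B
    using that by blast
  note x = x[unfolded power_functor_simps(1)]
  obtain e where e: "e \<in> hom C P0 A" "x = tuple I inc e" by (rule tuple_surj[OF P0 A x])
  have act: "act (power_functor C I V) h x = tuple I inc (h \<cdot> e)" if "h \<in> hom C A B" for h B
    using power_functor_simps(2)[OF that x] act_tuple[OF P0 that e(1)] e(2) by simp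
  have eD: "tuple I inc e \<in> FOb D A"
    unfolding D[OF A] using act[OF id_hom[OF A]] id_comp[OF e(1)] id_hom[OF A] by force
  have gen: "\<exists>h\<in>hom C A B. y = tuple I inc (h \<cdot> e)" if "B \<in> Ob C" "y \<in> FOb D B" for B y
    using that act unfolding D[OF that(1)] by blast
  let ?u = "f A (tuple I inc e)"
  have u: "?u \<in> hom C G A"
    using nat A eD unfolding nat_trans_def hom_functor_simps(1) by blast
  have fh: "f B (tuple I inc (h \<cdot> e)) = h \<cdot> ?u" if h: "h \<in> hom C A B" for h B
  proof -
    have "f B (act D h (tuple I inc e)) = act V h ?u"
      using nat homD[OF h] eD unfolding nat_trans_def by metis
    then show ?thesis using subfunctor_act[OF P0 sub h e(1) eD] V_act[OF h u] by simp
  qed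
  obtain P p e' where e': "e' \<in> hom C P0 P" "extremal_epi C e'" and p: "p \<in> hom C P A" "monomorphism C p" "p \<cdot> e' = e"
    by (rule factorisation[OF e(1)])
  obtain h k where eq: "is_equaliser C h k p" using SES p(2) unfolding SES_def regular_mono_def by blast
  then obtain B where h: "h \<in> hom C A B" and k: "k \<in> hom C A B" and hk: "h \<cdot> p = k \<cdot> p"
    and univ: "\<And>X l. X \<in> Ob C \<Longrightarrow> l \<in> hom C X A \<Longrightarrow> h \<cdot> l = k \<cdot> l \<Longrightarrow> \<exists>j. j \<in> hom C X P \<and> p \<cdot> j = l"
    using homD[OF p(1)] unfolding is_equaliser_def by (metis homD)
  have "h \<cdot> e = k \<cdot> e" using hk comp_assoc[OF e'(1) p(1)] h k p(3) by metis
  then have "h \<cdot> ?u = k \<cdot> ?u" using fh[OF h] fh[OF k] by simp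
  then obtain w where w: "w \<in> hom C G P" "p \<cdot> w = ?u" using univ[OF gen_ob u] by blast
  obtain v where v: "v \<in> hom C G P0" "e' \<cdot> v = w" by (rule projective_lift[OF e'(2,1) w(1)])
  have "?u = e \<cdot> v" using comp_assoc[OF v(1) e'(1) p(1)] v(2) w(2) p(3) by simp
  then show ?thesis using extends_iff_factors[OF P0 op e(1) eD gen] v(1) by blast
qed

text \<open>
  Choose, for each element \<open>u\<close> outside the image of \<open>m\<close>, a pair of arrows that agree on \<open>m\<close> but not on
  \<open>u\<close>, and combine them into one pair \<open>H, K\<close> of arrows into the product of their codomains. All elements
  of the equaliser of \<open>H\<close> and \<open>K\<close> come from \<open>m\<close>, so the comparison of \<open>m\<close> with this equaliser is
  a monomorphism that is surjective on elements.
\<close>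

lemma regular_mono_of_separating:
  assumes m: "m \<in> hom C A B" "monomorphism C m"
    and sep: "\<And>u. u \<in> hom C G B \<Longrightarrow>
       (\<And>X h k. h \<in> hom C B X \<Longrightarrow> k \<in> hom C B X \<Longrightarrow> h \<cdot> m = k \<cdot> m \<Longrightarrow> h \<cdot> u = k \<cdot> u) \<Longrightarrow>
       \<exists>v\<in>hom C G A. m \<cdot> v = u"
  shows "regular_mono C m"
proof -
  have A: "A \<in> Ob C" and B: "B \<in> Ob C" using m(1) hom_ob by auto
  define W where "W = {u \<in> hom C G B. \<not> (\<exists>v\<in>hom C G A. m \<cdot> v = u)}"
  have "\<exists>X h k. h \<in> hom C B X \<and> k \<in> hom C B X \<and> h \<cdot> m = k \<cdot> m \<and> h \<cdot> u \<noteq> k \<cdot> u" if "u \<in> W" for u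
    using that sep[of u] unfolding W_def by blast
  then obtain X h k where hk: "\<And>u. u \<in> W \<Longrightarrow>
      h u \<in> hom C B (X u) \<and> k u \<in> hom C B (X u) \<and> h u \<cdot> m = k u \<cdot> m \<and> h u \<cdot> u \<noteq> k u \<cdot> u"
    by metis
  have W: "small U W" by (rule small_subset[OF _ small_hom[OF gen_ob B]]) (auto simp: W_def)
  have X: "X u \<in> Ob C" if "u \<in> W" for u using hk[OF that] hom_ob by blast
  obtain L p where p: "L \<in> Ob C" "\<And>u. u \<in> W \<Longrightarrow> p u \<in> hom C L (X u)"
    and univ': "\<forall>Y\<in>Ob C. \<forall>f. (\<forall>u\<in>W. f u \<in> hom C Y (X u)) \<longrightarrow>
      (\<exists>!l. l \<in> hom C Y L \<and> (\<forall>u\<in>W. p u \<cdot> l = f u))"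
    by (rule product[where D = V and a = X, OF W]) (rule X, assumption, rule that)
  note univ = univ'[THEN bspec, THEN spec, THEN mp, OF _ ballI]
  obtain H where H: "H \<in> hom C B L" "\<forall>u\<in>W. p u \<cdot> H = h u"
    using univ[OF B, of h] hk by blast
  obtain K where K: "K \<in> hom C B L" "\<forall>u\<in>W. p u \<cdot> K = k u"
    using univ[OF B, of k] hk by blast
  have Hm: "H \<cdot> m \<in> hom C A L" and Km: "K \<cdot> m \<in> hom C A L" using comp_hom[OF m(1)] H K by auto
  have pHm: "p u \<cdot> (H \<cdot> m) = h u \<cdot> m" and pKm: "p u \<cdot> (K \<cdot> m) = h u \<cdot> m" if "u \<in> W" for u
    using comp_assoc[OF m(1) H(1) p(2)[OF that]] comp_assoc[OF m(1) K(1) p(2)[OF that]] H(2) K(2) hk[OF that] that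
    by auto
  have "\<exists>!l. l \<in> hom C A L \<and> (\<forall>u\<in>W. p u \<cdot> l = h u \<cdot> m)"
  proof (rule univ[OF A])
    show "h u \<cdot> m \<in> hom C A (X u)" if "u \<in> W" for u using comp_hom[OF m(1)] hk[OF that] by blast
  qed
  then have HKm: "H \<cdot> m = K \<cdot> m" by (rule ex1_unique) (use Hm Km pHm pKm in auto)
  obtain E q where q: "q \<in> hom C E B" "is_equaliser C H K q"
    by (rule equaliser[where D = V, OF H(1) K(1)])
  have HKq: "H \<cdot> q = K \<cdot> q" using q(2) unfolding is_equaliser_def by blast
  have univq: "\<exists>j. j \<in> hom C Y E \<and> q \<cdot> j = l" if "Y \<in> Ob C" "l \<in> hom C Y B" "H \<cdot> l = K \<cdot> l" for Y l
    using q that homD unfolding is_equaliser_def by metis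
  note qm = equaliser_mono[OF q(2)]
  obtain n where n: "n \<in> hom C A E" "q \<cdot> n = m" using univq[OF A m(1) HKm] by blast
  have nm: "monomorphism C n"
  proof (rule monoI[OF n(1)])
    fix Y f g assume f: "f \<in> hom C Y A" and g: "g \<in> hom C Y A" and "n \<cdot> f = n \<cdot> g"
    then have "m \<cdot> f = m \<cdot> g" using comp_assoc[OF f n(1) q(1)] comp_assoc[OF g n(1) q(1)] n(2) by simp
    then show "f = g" by (rule monoD[OF m(2,1) f g])
  qed
  have "isomorphism C n"
  proof (rule mono_surj_iso[OF nm n(1)])
    fix w assume w: "w \<in> hom C G E"
    have qw: "q \<cdot> w \<in> hom C G B" by (rule comp_hom[OF w q(1)])
    have HKw: "H \<cdot> (q \<cdot> w) = K \<cdot> (q \<cdot> w)" using comp_assoc[OF w q(1)] H(1) K(1) HKq by simp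
    have "q \<cdot> w \<notin> W"
    proof
      assume W: "q \<cdot> w \<in> W"
      have "h (q \<cdot> w) \<cdot> (q \<cdot> w) = k (q \<cdot> w) \<cdot> (q \<cdot> w)"
        using comp_assoc[OF qw H(1) p(2)[OF W]] comp_assoc[OF qw K(1) p(2)[OF W]] H(2) K(2) HKw W by simp
      then show False using hk[OF W] by blast
    qed
    then obtain v where v: "v \<in> hom C G A" "m \<cdot> v = q \<cdot> w" using qw unfolding W_def by blast
    have "q \<cdot> (n \<cdot> v) = q \<cdot> w" using comp_assoc[OF v(1) n(1) q(1)] n(2) v(2) by simp
    then have "n \<cdot> v = w" by (rule monoD[OF qm q(1) comp_hom[OF v(1) n(1)] w])
    then show "\<exists>v\<in>hom C G A. n \<cdot> v = w" using v(1) by blast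
  qed
  then obtain j where j: "j \<in> hom C E A" "n \<cdot> j = Id C E" using isoE n(1) by blast
  have "\<exists>!l'. l' \<in> hom C Y A \<and> m \<cdot> l' = l"
    if Y: "Y \<in> Ob C" and l: "l \<in> hom C Y B" "H \<cdot> l = K \<cdot> l" for Y l
  proof -
    obtain t where t: "t \<in> hom C Y E" "q \<cdot> t = l" using univq[OF Y l] by blast
    have "m \<cdot> (j \<cdot> t) = q \<cdot> ((n \<cdot> j) \<cdot> t)"
      using comp_assoc[OF comp_hom[OF t(1) j(1)] n(1) q(1)] comp_assoc[OF t(1) j(1) n(1)] n(2) by simp
    also have "\<dots> = l" using j(2) id_comp[OF t(1)] t(2) by simp
    finally show ?thesis using comp_hom[OF t(1) j(1)] monoD[OF m(2,1)] by blast
  qed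
  then have "is_equaliser C H K m"
    unfolding is_equaliser_def using A B p(1) m(1) H(1) K(1) HKm by blast
  then show ?thesis unfolding regular_mono_def by blast
qed

text \<open>
  Let \<open>c\<close> be a cover of the domain of a monomorphism \<open>m\<close>. An element \<open>u\<close> that no pair of arrows agreeing
  on \<open>m\<close> separates is the value at \<open>m \<cdot> c\<close> of an operation on the principal subfunctor that \<open>m \<cdot> c\<close>
  generates. Extending it factors \<open>u\<close> through \<open>m\<close>.
\<close>

lemma principal_extends_imp_SES:
  assumes ext: "\<And>(I :: 'u set) D f. small U I \<Longrightarrow> implicit_partial_operation U C V I D f \<Longrightarrow>
     principal_subfunctor U C D (power_functor C I V) \<Longrightarrow> extends_to_total C V I D f"
  shows "SES C"
  unfolding SES_def
proof (intro allI impI)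
  fix m assume mono: "monomorphism C m"
  obtain A B where m: "m \<in> hom C A B"
    using mono_hom[OF mono] by blast
  have A: "A \<in> Ob C" using m(1) hom_ob by blast
  obtain I :: "'u set" and P inc c where I: "small U I" and P: "is_copower C I G P inc"
    and c: "c \<in> hom C P A" "extremal_epi C c" by (rule canonical_cover[OF A])
  have e: "m \<cdot> c \<in> hom C P B" by (rule comp_hom[OF c(1) m])
  show "regular_mono C m"
  proof (rule regular_mono_of_separating[OF m mono])
    fix u assume u: "u \<in> hom C G B"
      and sep: "\<And>X h k. h \<in> hom C B X \<Longrightarrow> k \<in> hom C B X \<Longrightarrow> h \<cdot> m = k \<cdot> m \<Longrightarrow> h \<cdot> u = k \<cdot> u"
    have coh: "\<forall>X. \<forall>h\<in>hom C B X. \<forall>k\<in>hom C B X. h \<cdot> m \<cdot> c = k \<cdot> m \<cdot> c \<longrightarrow> h \<cdot> u = k \<cdot> u"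
    proof (intro allI ballI impI)
      fix X h k assume h: "h \<in> hom C B X" and k: "k \<in> hom C B X" and eq: "h \<cdot> m \<cdot> c = k \<cdot> m \<cdot> c"
      show "h \<cdot> u = k \<cdot> u"
      proof (rule sep[OF h k], rule epiD[OF _ c(1) comp_hom[OF m h] comp_hom[OF m k]])
        show "epimorphism C c" using c(2) by (simp add: extremal_epi_def)
        show "(h \<cdot> m) \<cdot> c = (k \<cdot> m) \<cdot> c"
          using comp_assoc[OF c(1) m h] comp_assoc[OF c(1) m k] eq by simp
      qed
    qed
    obtain D f where "implicit_partial_operation U C V I D f" "principal_subfunctor U C D (power_functor C I V)"
      and iff: "extends_to_total C V I D f \<longleftrightarrow> (\<exists>v\<in>hom C G P. u = (m \<cdot> c) \<cdot> v)"
      using principal_operation[OF P e u coh] by blast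
    then obtain v where v: "v \<in> hom C G P" "u = (m \<cdot> c) \<cdot> v" using ext[OF I] by blast
    then have "m \<cdot> (c \<cdot> v) = u" using comp_assoc[OF v(1) c(1) m(1)] by simp
    then show "\<exists>v\<in>hom C G A. m \<cdot> v = u" using comp_hom[OF v(1) c(1)] by blast
  qed
qed

section \<open>Continuous subfunctors of powers\<close>

text \<open>
  By Yoneda, a universal element is the same as a representation.
\<close>

lemma representableI:
  assumes D: "set_functor C U D" and P: "P \<in> Ob C" and e: "e \<in> FOb D P"
    and ex: "\<And>A y. A \<in> Ob C \<Longrightarrow> y \<in> FOb D A \<Longrightarrow> \<exists>h\<in>hom C P A. act D h e = y"
    and inj: "\<And>A h k. h \<in> hom C P A \<Longrightarrow> k \<in> hom C P A \<Longrightarrow> act D h e = act D k e \<Longrightarrow> h = k"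
  shows "representable C D"
  unfolding representable_def
proof (intro bexI[OF _ P] exI[of _ "\<lambda>A h. act D h e"] conjI ballI)
  interpret D: set_functor C U D by (rule D)
  show "nat_trans C (hom_functor C P) D (\<lambda>A h. act D h e)"
    unfolding nat_trans_def
  proof (intro conjI ballI)
    show "(\<lambda>h. act D h e) \<in> FOb (hom_functor C P) A \<rightarrow> FOb D A" for A
      using D.act_in e by (auto simp: hom_functor_simps)
    fix h k assume h: "h \<in> Ar C" and k: "k \<in> FOb (hom_functor C P) (Dom C h)"
    note h = hom_Ar[OF h] and k = k[unfolded hom_functor_simps(1)]
    show "act D (act (hom_functor C P) h k) e = act D h (act D k e)"
      using D.act_comp[OF k h e] hom_functor_simps(2)[OF h k] by simp
  qed
  show "bij_betw (\<lambda>h. act D h e) (hom C P A) (FOb D A)" if A: "A \<in> Ob C" for A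
    unfolding bij_betw_def
  proof
    show "inj_on (\<lambda>h. act D h e) (hom C P A)" using inj by (blast intro: inj_onI)
    show "(\<lambda>h. act D h e) ` hom C P A = FOb D A" using ex[OF A] D.act_in[OF _ e] by blast
  qed
qed

text \<open>
  Every element of \<open>D\<close> is the image of a minimal one, and by \<open>minimal_separates\<close> a minimal element is
  the tuple of an epimorphism out of \<open>P0\<close>. As \<open>C\<close> is well-copowered, a small set \<open>N\<close> of epimorphisms
  suffices to generate \<open>D\<close>. The tuples of these combine into one element \<open>z\<close> at the product of their
  codomains, which then generates \<open>D\<close> alone. A minimal element below \<open>z\<close> still generates \<open>D\<close>, and it
  does so uniquely.
\<close>

lemma continuous_imp_representable:
  assumes wc: "well_copowered U C" and I: "small U I" and sub: "subfunctor U C D (power_functor C I V)"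
    and cont: "preserves_limits U C (set_cat U) D"
  shows "representable C D"
proof -
  obtain P0 inc where P0: "is_copower C I G P0 inc" by (rule copower_exists[OF I])
  interpret D: set_functor C U D by (rule subfunctor_set_functor[OF sub])
  have D: "continuous D" using D.is_fun cont by (simp add: continuous_def)
  note act = subfunctor_act[OF P0 sub]
  \<comment> \<open>The quotients of \<open>P0\<close> whose tuple lies in \<open>D\<close>, and one representative of each isomorphism class.\<close>
  define Q where "Q = {e \<in> epi_quotients C P0. tuple I inc e \<in> FOb D (Cod C e)}"
  define rep where "rep c = (SOME e. e \<in> c)" for c :: "'a set"
  define N where "N = rep ` ((\<lambda>e. quotient_iso C P0 `` {e}) ` Q)"
  have Q_hom: "e \<in> hom C P0 (Cod C e)" if "e \<in> Q" for e
    using that unfolding Q_def epi_quotients_def epimorphism_def by (auto simp: hom_def)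
  have refl: "(e, e) \<in> quotient_iso C P0" if "e \<in> Q" for e
  proof -
    have id: "Id C (Cod C e) \<in> hom C (Cod C e) (Cod C e)" using id_hom hom_ob Q_hom[OF that] by blast
    then have "isomorphism C (Id C (Cod C e))"
      unfolding isomorphism_def using comp_id[OF id] homD[OF id] by auto
    then show ?thesis using id id_comp[OF Q_hom[OF that]] that unfolding quotient_iso_def Q_def by blast
  qed
  have rep: "(e, rep (quotient_iso C P0 `` {e})) \<in> quotient_iso C P0" if "e \<in> Q" for e
    using someI[of "\<lambda>e'. e' \<in> quotient_iso C P0 `` {e}" e] refl[OF that] unfolding rep_def by blast
  have "(\<lambda>e. quotient_iso C P0 `` {e}) ` Q \<subseteq> epi_quotients C P0 // quotient_iso C P0"
    unfolding Q_def quotient_def by blast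
  then have "small U ((\<lambda>e. quotient_iso C P0 `` {e}) ` Q)"
    by (rule small_subset) (use wc P0_ob[OF P0] in \<open>simp add: well_copowered_def\<close>)
  then have N: "small U N" unfolding N_def by (rule small_image)
  have N_D: "n \<in> hom C P0 (Cod C n) \<and> tuple I inc n \<in> FOb D (Cod C n)" if n: "n \<in> N" for n
  proof -
    obtain e where e: "e \<in> Q" "n = rep (quotient_iso C P0 `` {e})" using n unfolding N_def by blast
    obtain i where i: "i \<in> hom C (Cod C e) (Cod C n)" "i \<cdot> e = n" "n \<in> epi_quotients C P0"
    proof -
      have "(e, n) \<in> quotient_iso C P0" using rep[OF e(1)] e(2) by simp
      then show thesis using that unfolding quotient_iso_def by blast
    qed
    have eD: "tuple I inc e \<in> FOb D (Cod C e)" using e(1) by (simp add: Q_def)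
    show ?thesis
      using D.act_in[OF i(1) eD] act[OF i(1) Q_hom[OF e(1)] eD] i(2) comp_hom[OF Q_hom[OF e(1)] i(1)] by simp
  qed
  have weakly_initial: "\<exists>n\<in>N. \<exists>h\<in>hom C (Cod C n) A. act D h (tuple I inc n) = x"
    if A: "A \<in> Ob C" and x: "x \<in> FOb D A" for A x
  proof -
    obtain P p y where p: "p \<in> hom C P A" and y: "minimal D P y" "act D p y = x"
      using minimal_subobject[OF D A x] by blast
    have P: "P \<in> Ob C" and yD: "y \<in> FOb D P" using hom_ob[OF p] y(1) by (auto simp: minimal_def)
    obtain e where e: "e \<in> hom C P0 P" "y = tuple I inc e"
      by (rule tuple_surj[OF P0 P subfunctor_in[OF sub P yD]])
    note eD = yD[unfolded e(2)]
    have "epimorphism C e"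
    proof (rule epiI[OF e(1)])
      fix X h k assume h: "h \<in> hom C P X" and k: "k \<in> hom C P X" and "h \<cdot> e = k \<cdot> e"
      then have "act D h y = act D k y" using act[OF h e(1) eD] act[OF k e(1) eD] e(2) by simp
      then show "h = k" by (rule minimal_separates[OF D y(1) h k])
    qed
    then have eQ: "e \<in> Q" using eD homD[OF e(1)] by (simp add: Q_def epi_quotients_def)
    let ?n = "rep (quotient_iso C P0 `` {e})"
    have nN: "?n \<in> N" unfolding N_def using eQ by blast
    obtain i where i: "i \<in> hom C P (Cod C ?n)" "isomorphism C i" "i \<cdot> e = ?n"
    proof -
      have "\<exists>i\<in>hom C (Cod C e) (Cod C ?n). isomorphism C i \<and> i \<cdot> e = ?n"
        using rep[OF eQ] unfolding quotient_iso_def[of C P0, THEN eqset_imp_iff] by simp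
      then show thesis using that homD[OF e(1)] by blast
    qed
    obtain j where j: "j \<in> hom C (Cod C ?n) P" "j \<cdot> i = Id C P" using isoE[OF i(2,1)] by blast
    have "act D j (tuple I inc ?n) = tuple I inc (j \<cdot> ?n)"
      using act[OF j(1)] N_D[OF nN] by blast
    also have "j \<cdot> ?n = e" using comp_assoc[OF e(1) i(1) j(1)] i(3) j(2) id_comp[OF e(1)] by simp
    finally have "act D (p \<cdot> j) (tuple I inc ?n) = x"
      using D.act_comp[OF j(1) p] N_D[OF nN] e(2) y(2) by simp
    then show ?thesis using nN comp_hom[OF j(1) p] by blast
  qed
  have NOb: "Cod C n \<in> Ob C" if "n \<in> N" for n using N_D[OF that] hom_ob by blast
  obtain L p where L: "L \<in> Ob C" and p: "\<And>n. n \<in> N \<Longrightarrow> p n \<in> hom C L (Cod C n)"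
    and lift: "\<And>x. continuous D \<Longrightarrow> (\<And>n. n \<in> N \<Longrightarrow> x n \<in> FOb D (Cod C n)) \<Longrightarrow> \<exists>z\<in>FOb D L. \<forall>n\<in>N. act D (p n) z = x n"
    by (rule product[OF N NOb, of "\<lambda>n. n" D]) blast+
  obtain z where z: "z \<in> FOb D L" "\<forall>n\<in>N. act D (p n) z = tuple I inc n"
    using lift[OF D, of "tuple I inc"] N_D by blast
  obtain P q e where q: "q \<in> hom C P L" and e: "minimal D P e" "act D q e = z"
    using minimal_subobject[OF D L z(1)] by blast
  have eD: "e \<in> FOb D P" using e(1) by (simp add: minimal_def)
  show ?thesis
  proof (rule representableI[OF D.set_functor_axioms _ eD])
    show "P \<in> Ob C" using hom_ob[OF q] by blast
    fix A y assume A: "A \<in> Ob C" "y \<in> FOb D A"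
    then obtain n h where n: "n \<in> N" "h \<in> hom C (Cod C n) A" "act D h (tuple I inc n) = y"
      using weakly_initial by blast
    have pq: "p n \<cdot> q \<in> hom C P (Cod C n)" by (rule comp_hom[OF q p[OF n(1)]])
    have "act D (h \<cdot> p n \<cdot> q) e = y"
      using D.act_comp[OF pq n(2) eD] D.act_comp[OF q p[OF n(1)] eD] e(2) z(2) n(1,3) by simp
    then show "\<exists>h\<in>hom C P A. act D h e = y" using comp_hom[OF pq n(2)] by blast
  qed (rule minimal_separates[OF D e(1)])
qed

end

theorem theorem1p1:
  fixes U :: "'u itself" and C :: "('o, 'a) cat" and G :: 'o and V :: "('o, 'a, 'a) set_func"
  assumes "universe U"
    and "category C"
    and "locally_small U C"
    and "complete U C"
    and "extremal_projective_generator U C G"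
    and "V = hom_functor C G"
  shows "(ES C \<longleftrightarrow>
            (\<forall>(I :: 'u set) D f. small U I \<and> implicit_partial_operation U C V I D f \<and>
               representable C D \<longrightarrow> extends_to_total C V I D f)) \<and>
         (SES C \<longleftrightarrow>
            (\<forall>(I :: 'u set) D f. small U I \<and> implicit_partial_operation U C V I D f \<and>
               principal_subfunctor U C D (power_functor C I V) \<longrightarrow>
               extends_to_total C V I D f)) \<and>
         (well_copowered U C \<longrightarrow>
            (ES C \<longleftrightarrow>
               (\<forall>(I :: 'u set) D f. small U I \<and> implicit_partial_operation U C V I D f \<and>
                  preserves_limits U C (set_cat U) D \<longrightarrow> extends_to_total C V I D f)))"
proof -
  interpret projective_generator C U G
    using assms(1-5)
    by (simp add: projective_generator_def projective_generator_axioms_def complete_category_def complete_category_axioms_def)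
  have i: "ES C \<longleftrightarrow>
      (\<forall>(I :: 'u set) D f. small U I \<and> implicit_partial_operation U C V I D f \<and>
         representable C D \<longrightarrow> extends_to_total C V I D f)"
    unfolding assms(6) using ES_imp_representable_extends representable_extends_imp_ES by blast
  have ii: "SES C \<longleftrightarrow>
      (\<forall>(I :: 'u set) D f. small U I \<and> implicit_partial_operation U C V I D f \<and>
         principal_subfunctor U C D (power_functor C I V) \<longrightarrow> extends_to_total C V I D f)"
    unfolding assms(6) using SES_imp_principal_extends principal_extends_imp_SES by blast
  have rep_iff: "representable C D \<longleftrightarrow> preserves_limits U C (set_cat U) D"
    if wc: "well_copowered U C" and I: "small U I" and op: "implicit_partial_operation U C V I D f"
    for I :: "'u set" and D f
  proof -
    have sub: "subfunctor U C D (power_functor C I (hom_functor C G))"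
      using op unfolding implicit_partial_operation_def assms(6) by blast
    then have D: "set_functor C U D"
      by unfold_locales (simp add: subfunctor_def)
    show ?thesis
      using representable_preserves_limits[OF D] continuous_imp_representable[OF wc I sub] by blast
  qed
  show ?thesis
  proof (intro conjI impI)
    assume wc: "well_copowered U C"
    show "ES C \<longleftrightarrow>
      (\<forall>(I :: 'u set) D f. small U I \<and> implicit_partial_operation U C V I D f \<and>
         preserves_limits U C (set_cat U) D \<longrightarrow> extends_to_total C V I D f)"
      unfolding i using rep_iff[OF wc] by blast
  qed (rule i ii)+
qed

end
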